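(* Let $X$ be a connected quandle of type $t_X<\infty$ ($X$ may be infinite). Then the second group homology $H_2^{\mathrm{gr}}(\mathrm{As}(X))$ is annihilated by $t_X$. Moreover, the abelian group $\mathrm{Ker}(\psi_X)$ is $[1/t_X]$-isomorphic to $\mathbb{Z}\oplus H_2^{\mathrm{gr}}(\mathrm{Inn}(X))$.
   Context: A quandle is a set $X$ with a binary operation $\lhd$ such that $a\lhd a=a$ for all $a$, each map $x\mapsto x\lhd a$ is a bijection of $X$, and $(a\lhd b)\lhd c=(a\lhd c)\lhd(b\lhd c)$ for all $a,b,c$. The adjoint group $\mathrm{As}(X)$ is the group with generators $e_x$ ($x\in X$) and relations $e_{x\lhd y}=e_y^{-1}e_xe_y$ for all $x,y\in X$. It acts on $X$ from the right by $x\cdot e_y=x\lhd y$; $X$ is connected if this action is transitive. Let $\psi_X:\mathrm{As}(X)\to\mathfrak S_X$ be the homomorphism given by this action and $\mathrm{Inn}(X)=\mathrm{Im}(\psi_X)$ (so $\mathrm{Ker}(\psi_X)$ is central in $\mathrm{As}(X)$). For $N\ge1$, $x\lhd^N y$ denotes the $N$-fold application of $\bullet\lhd y$ to $x$; $X$ is of type $t_X$ if $t_X$ is the smallest positive integer $N$ with $x\lhd^N y=x$ for all $x,y\in X$. $H_n^{\mathrm{gr}}$ denotes group homology with trivial $\mathbb{Z}$ coefficients. A homomorphism $f:A\to B$ of abelian groups is a $[1/N]$-isomorphism if its localization at every prime $\ell$ not dividing $N$ is an isomorphism; $A$ is $[1/N]$-isomorphic to $B$ if such an $f$ exists. *)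

theory Defs
  imports "HOL-Algebra.Algebra" "HOL-Computational_Algebra.Primes"
begin

definition quandle :: "'a set \<Rightarrow> ('a \<Rightarrow> 'a \<Rightarrow> 'a) \<Rightarrow> bool" where
  "quandle Q qop \<longleftrightarrow>
     (\<forall>x\<in>Q. \<forall>y\<in>Q. qop x y \<in> Q) \<and>
     (\<forall>a\<in>Q. qop a a = a) \<and>
     (\<forall>a\<in>Q. bij_betw (\<lambda>x. qop x a) Q Q) \<and>
     (\<forall>a\<in>Q. \<forall>b\<in>Q. \<forall>c\<in>Q. qop (qop a b) c = qop (qop a c) (qop b c))"

definition has_finite_type :: "'a set \<Rightarrow> ('a \<Rightarrow> 'a \<Rightarrow> 'a) \<Rightarrow> bool" where
  "has_finite_type Q qop \<longleftrightarrow>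
     (\<exists>N::nat. N > 0 \<and> (\<forall>x\<in>Q. \<forall>y\<in>Q. ((\<lambda>z. qop z y) ^^ N) x = x))"

definition quandle_type :: "'a set \<Rightarrow> ('a \<Rightarrow> 'a \<Rightarrow> 'a) \<Rightarrow> nat" where
  "quandle_type Q qop =
     (LEAST N::nat. N > 0 \<and> (\<forall>x\<in>Q. \<forall>y\<in>Q. ((\<lambda>z. qop z y) ^^ N) x = x))"

text \<open>A word is a list of letters (x, True) = e_x and (x, False) = e_x^{-1}.\<close>

type_synonym 'a word = "('a \<times> bool) list"

inductive_set as_rel :: "'a set \<Rightarrow> ('a \<Rightarrow> 'a \<Rightarrow> 'a) \<Rightarrow> ('a word \<times> 'a word) set"
  for Q qop where
  refl: "w \<in> lists (Q \<times> UNIV) \<Longrightarrow> (w, w) \<in> as_rel Q qop"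
| sym: "(u, v) \<in> as_rel Q qop \<Longrightarrow> (v, u) \<in> as_rel Q qop"
| trans: "(u, v) \<in> as_rel Q qop \<Longrightarrow> (v, w) \<in> as_rel Q qop \<Longrightarrow> (u, w) \<in> as_rel Q qop"
| cancel: "u \<in> lists (Q \<times> UNIV) \<Longrightarrow> v \<in> lists (Q \<times> UNIV) \<Longrightarrow> x \<in> Q \<Longrightarrow>
     (u @ [(x, b), (x, \<not> b)] @ v, u @ v) \<in> as_rel Q qop"
| rel: "u \<in> lists (Q \<times> UNIV) \<Longrightarrow> v \<in> lists (Q \<times> UNIV) \<Longrightarrow> x \<in> Q \<Longrightarrow> y \<in> Q \<Longrightarrow>
     (u @ [(qop x y, True)] @ v, u @ [(y, False), (x, True), (y, True)] @ v) \<in> as_rel Q qop"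

definition As :: "'a set \<Rightarrow> ('a \<Rightarrow> 'a \<Rightarrow> 'a) \<Rightarrow> ('a word set) monoid" where
  "As Q qop =
    \<lparr>carrier = lists (Q \<times> UNIV) // as_rel Q qop,
     monoid.mult = (\<lambda>A B. \<Union>a\<in>A. \<Union>b\<in>B. as_rel Q qop `` {a @ b}),
     one = as_rel Q qop `` {[]}\<rparr>"

fun word_act :: "'a set \<Rightarrow> ('a \<Rightarrow> 'a \<Rightarrow> 'a) \<Rightarrow> 'a \<Rightarrow> 'a word \<Rightarrow> 'a" where
  "word_act Q qop x [] = x"
| "word_act Q qop x ((y, True) # w) = word_act Q qop (qop x y) w"
| "word_act Q qop x ((y, False) # w) = word_act Q qop (the_inv_into Q (\<lambda>z. qop z y) x) w"

definition connected_quandle :: "'a set \<Rightarrow> ('a \<Rightarrow> 'a \<Rightarrow> 'a) \<Rightarrow> bool" where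
  "connected_quandle Q qop \<longleftrightarrow>
     (\<forall>x\<in>Q. \<forall>y\<in>Q. \<exists>w\<in>lists (Q \<times> UNIV). word_act Q qop x w = y)"

definition psi :: "'a set \<Rightarrow> ('a \<Rightarrow> 'a \<Rightarrow> 'a) \<Rightarrow> 'a word set \<Rightarrow> ('a \<Rightarrow> 'a)" where
  "psi Q qop C = (\<lambda>x\<in>Q. word_act Q qop x (SOME w. w \<in> C))"

definition Ker_psi :: "'a set \<Rightarrow> ('a \<Rightarrow> 'a \<Rightarrow> 'a) \<Rightarrow> ('a word set) monoid" where
  "Ker_psi Q qop = (As Q qop)\<lparr>carrier := {C \<in> carrier (As Q qop). psi Q qop C = (\<lambda>x\<in>Q. x)}\<rparr>"

definition Inn :: "'a set \<Rightarrow> ('a \<Rightarrow> 'a \<Rightarrow> 'a) \<Rightarrow> ('a \<Rightarrow> 'a) monoid" where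
  "Inn Q qop = (BijGroup Q)\<lparr>carrier := psi Q qop ` carrier (As Q qop)\<rparr>"

section \<open>Group homology with trivial integer coefficients (bar complex)\<close>

definition chains :: "('g, 'b) monoid_scheme \<Rightarrow> nat \<Rightarrow> ('g list \<Rightarrow> int) set" where
  "chains G n = {c. finite {xs. c xs \<noteq> 0} \<and>
                    (\<forall>xs. c xs \<noteq> 0 \<longrightarrow> length xs = n \<and> set xs \<subseteq> carrier G)}"

definition chain_group :: "('g, 'b) monoid_scheme \<Rightarrow> nat \<Rightarrow> ('g list \<Rightarrow> int) monoid" where
  "chain_group G n = \<lparr>carrier = chains G n, monoid.mult = (\<lambda>a b xs. a xs + b xs), one = (\<lambda>_. 0)\<rparr>"

definition face :: "('g, 'b) monoid_scheme \<Rightarrow> nat \<Rightarrow> 'g list \<Rightarrow> 'g list" where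
  "face G i xs =
     (if i = 0 then tl xs
      else if i = length xs then butlast xs
      else take (i - 1) xs @ [xs ! (i - 1) \<otimes>\<^bsub>G\<^esub> xs ! i] @ drop (i + 1) xs)"

definition bd_basis :: "('g, 'b) monoid_scheme \<Rightarrow> 'g list \<Rightarrow> 'g list \<Rightarrow> int" where
  "bd_basis G xs = (\<lambda>ys. \<Sum>i\<le>length xs. if face G i xs = ys then (-1) ^ i else 0)"

definition boundary :: "('g, 'b) monoid_scheme \<Rightarrow> ('g list \<Rightarrow> int) \<Rightarrow> ('g list \<Rightarrow> int)" where
  "boundary G c = (\<lambda>ys. \<Sum>xs\<in>{xs. c xs \<noteq> 0}. c xs * bd_basis G xs ys)"

definition cycles :: "('g, 'b) monoid_scheme \<Rightarrow> nat \<Rightarrow> ('g list \<Rightarrow> int) set" where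
  "cycles G n = {c \<in> chains G n. boundary G c = (\<lambda>_. 0)}"

definition boundaries :: "('g, 'b) monoid_scheme \<Rightarrow> nat \<Rightarrow> ('g list \<Rightarrow> int) set" where
  "boundaries G n = boundary G ` chains G (Suc n)"

definition group_homology :: "('g, 'b) monoid_scheme \<Rightarrow> nat \<Rightarrow> ('g list \<Rightarrow> int) set monoid" where
  "group_homology G n = ((chain_group G n)\<lparr>carrier := cycles G n\<rparr>) Mod (boundaries G n)"

text \<open>A_(l) = A \<otimes> Z_(l): pairs (a, s) with s not divisible by l, standing for a/s,
  where (a,s) ~ (b,u) iff v(u a - s b) = 0 for some v not divisible by l.\<close>

definition loc_rel :: "('a, 'b) monoid_scheme \<Rightarrow> nat \<Rightarrow> (('a \<times> nat) \<times> ('a \<times> nat)) set" where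
  "loc_rel A l = {((a, s), (b, u)).
      a \<in> carrier A \<and> b \<in> carrier A \<and> \<not> l dvd s \<and> \<not> l dvd u \<and>
      (\<exists>v::nat. \<not> l dvd v \<and> a [^]\<^bsub>A\<^esub> (u * v) = b [^]\<^bsub>A\<^esub> (s * v))}"

definition loc_carrier :: "('a, 'b) monoid_scheme \<Rightarrow> nat \<Rightarrow> ('a \<times> nat) set set" where
  "loc_carrier A l = (carrier A \<times> {s. \<not> l dvd s}) // loc_rel A l"

definition loc_map :: "('c, 'd) monoid_scheme \<Rightarrow> nat \<Rightarrow> ('a \<Rightarrow> 'c) \<Rightarrow> ('a \<times> nat) set \<Rightarrow> ('c \<times> nat) set" where
  "loc_map B l f C = (\<Union>(a, s)\<in>C. loc_rel B l `` {(f a, s)})"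

definition inv_N_iso :: "nat \<Rightarrow> ('a, 'b) monoid_scheme \<Rightarrow> ('c, 'd) monoid_scheme \<Rightarrow> ('a \<Rightarrow> 'c) \<Rightarrow> bool" where
  "inv_N_iso N A B f \<longleftrightarrow> f \<in> hom A B \<and>
     (\<forall>l. Factorial_Ring.prime (l::nat) \<and> \<not> l dvd N \<longrightarrow> bij_betw (loc_map B l f) (loc_carrier A l) (loc_carrier B l))"

definition inv_N_isomorphic :: "nat \<Rightarrow> ('a, 'b) monoid_scheme \<Rightarrow> ('c, 'd) monoid_scheme \<Rightarrow> bool" where
  "inv_N_isomorphic N A B \<longleftrightarrow> (\<exists>f. inv_N_iso N A B f)"

end

(*
  Let t be the type and e a generator of As(X). The element c = e^t is central and does not depend
  on the choice of e. Given a 2-cocycle f on As(X) with values in a trivial module A, push the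
  central extension defined by f forward along multiplication by t on A. The t-th powers of the
  lifts of the generators say how to correct these lifts so that they satisfy the relations of
  As(X); hence the pushed-out extension splits: t f is the coboundary of a map sigma. For the
  universal cocycle with values in A = C_2/B_2 this gives t H_2(As(X)) = 0.

  Applied to the pullback of the universal cocycle of Inn(X), the map sigma restricts, up to a
  constant, to a homomorphism F from Ker(psi) to H_2(Inn(X)). A section of As(X) -> Inn(X) yields a
  homomorphism kappa in the opposite direction with F kappa = -t on H_2(Inn(X)). As every
  homomorphism from As(X) to an abelian group factors through the degree, t annihilates the common
  kernel of deg and F, and t^2 annihilates the cokernel of (deg, F).
*)
theory Submission
  imports Defs
begin

section \<open>The adjoint group and its action\<close>

text \<open>Why t-th powers give the right correction: choose lifts of the generators to the
  extension by f. They satisfy the relation for (x, y) up to some a in A, and as A is central, their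
  t-th powers satisfy it up to t a. All these powers lift the one element c. Since c is also a power
  of e_y, its lifts commute with the lift of e_y, so conjugation does not change them. Hence t a is
  a difference of two of the powers, one attached to each of the generators being compared, and can
  be absorbed into the lifts. No finiteness of X enters.

  C_2/B_2 is larger than H_2, so it has to be shown that F lands in H_2; this needs the explicit
  values of sigma on the generators.

  For the common kernel, kappa sigma is combined with t times the Ker(psi)-coordinate given by the
  section. The result is a homomorphism on As(X); it vanishes in degree 0, and where F vanishes too
  it is the t-th power map.

  The exponent t^2 has two sources: powers of c realise only the degrees in t Z, and removing their
  unwanted F-component through kappa costs another factor t.\<close>

lemma (in group) inv_mult_cancel: "x \<in> carrier G \<Longrightarrow> y \<in> carrier G \<Longrightarrow> inv x \<otimes> (x \<otimes> y) = y"
  by (simp add: m_assoc[symmetric])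

lemma (in group) mult_inv_cancel: "x \<in> carrier G \<Longrightarrow> y \<in> carrier G \<Longrightarrow> x \<otimes> (inv x \<otimes> y) = y"
  by (simp add: m_assoc[symmetric])

abbreviation words :: "'a set \<Rightarrow> 'a word set" where
  "words Q \<equiv> lists (Q \<times> UNIV)"

definition word_inv :: "'a word \<Rightarrow> 'a word" where
  "word_inv w = rev (map (\<lambda>(x, b). (x, \<not> b)) w)"

locale quandle_on =
  fixes Q :: "'a set" and qop :: "'a \<Rightarrow> 'a \<Rightarrow> 'a"
  assumes quandle: "quandle Q qop"
begin

lemma qop_closed: "x \<in> Q \<Longrightarrow> y \<in> Q \<Longrightarrow> qop x y \<in> Q"
  and qop_bij: "y \<in> Q \<Longrightarrow> bij_betw (\<lambda>x. qop x y) Q Q"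
  and qop_distrib: "x \<in> Q \<Longrightarrow> y \<in> Q \<Longrightarrow> z \<in> Q \<Longrightarrow> qop (qop x y) z = qop (qop x z) (qop y z)"
  using quandle unfolding quandle_def by blast+

abbreviation G where "G \<equiv> As Q qop"

abbreviation wcl :: "'a word \<Rightarrow> 'a word set" where "wcl w \<equiv> as_rel Q qop `` {w}"

lemma as_rel_words: "(u, v) \<in> as_rel Q qop \<Longrightarrow> u \<in> words Q \<and> v \<in> words Q"
  by (induction rule: as_rel.induct) (auto simp: qop_closed)

lemma equiv_as_rel: "equiv (words Q) (as_rel Q qop)"
  by (rule equivI)
     (auto intro!: refl_onI symI transI dest: as_rel_words
           intro: as_rel.refl as_rel.sym as_rel.trans)

lemma as_rel_append:
  assumes "(u, v) \<in> as_rel Q qop" "a \<in> words Q" "b \<in> words Q"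
  shows "(a @ u @ b, a @ v @ b) \<in> as_rel Q qop"
  using assms
proof (induction rule: as_rel.induct)
  case (cancel u v x c)
  then show ?case
    using as_rel.cancel[of "a @ u" Q "v @ b" x c qop] by simp
next
  case (rel u v x y)
  then show ?case
    using as_rel.rel[of "a @ u" Q "v @ b" x y qop] by simp
next
  case (trans u v w)
  then show ?case by (meson as_rel.trans)
qed (simp_all add: as_rel.refl as_rel.sym)

lemma as_rel_append2:
  assumes "(u, v) \<in> as_rel Q qop" "(u', v') \<in> as_rel Q qop"
  shows "(u @ u', v @ v') \<in> as_rel Q qop"
proof (rule as_rel.trans)
  show "(u @ u', v @ u') \<in> as_rel Q qop"
    using as_rel_append[OF assms(1), of "[]" u'] as_rel_words[OF assms(2)] by simp
  show "(v @ u', v @ v') \<in> as_rel Q qop"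
    using as_rel_append[OF assms(2), of v "[]"] as_rel_words[OF assms(1)] by simp
qed

lemma wcl_eq: "u \<in> words Q \<Longrightarrow> v \<in> words Q \<Longrightarrow> wcl u = wcl v \<longleftrightarrow> (u, v) \<in> as_rel Q qop"
  using equiv_as_rel by (metis eq_equiv_class_iff)

lemma wcl_in: "w \<in> words Q \<Longrightarrow> wcl w \<in> carrier G"
  by (simp add: As_def quotientI)

lemma carrier_AsE:
  assumes "g \<in> carrier G"
  obtains w where "w \<in> words Q" "g = wcl w"
  using assms that unfolding As_def by (auto elim!: quotientE)

lemma wcl_mult:
  assumes "u \<in> words Q" "v \<in> words Q"
  shows "wcl u \<otimes>\<^bsub>G\<^esub> wcl v = wcl (u @ v)"
proof -
  have "wcl (a @ b) = wcl (u @ v)" if "a \<in> wcl u" "b \<in> wcl v" for a b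
    using that as_rel_append2[of u a v b] as_rel_words[of u a] as_rel_words[of v b]
    by (metis Image_singleton_iff append_in_lists_conv as_rel.sym wcl_eq)
  moreover have "u \<in> wcl u" "v \<in> wcl v"
    using assms by (auto intro: as_rel.refl)
  \<comment> \<open>The union that defines the product runs over nonempty sets of representatives,
    and every pair contributes the same class.\<close>
  ultimately have "(\<Union>a\<in>wcl u. \<Union>b\<in>wcl v. wcl (a @ b)) = wcl (u @ v)"
    by blast
  then show ?thesis
    by (simp add: As_def)
qed

lemma one_As: "\<one>\<^bsub>G\<^esub> = wcl []"
  by (simp add: As_def)

lemma word_inv_words: "w \<in> words Q \<Longrightarrow> word_inv w \<in> words Q"
  by (induction w) (auto simp: word_inv_def)

lemma word_inv_left: "w \<in> words Q \<Longrightarrow> (word_inv w @ w, []) \<in> as_rel Q qop"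
proof (induction w)
  case Nil
  then show ?case by (auto simp: word_inv_def intro: as_rel.refl)
next
  case (Cons l w)
  obtain x b where l: "l = (x, b)" by force
  have "(word_inv w @ [(x, \<not> b), (x, \<not> \<not> b)] @ w, word_inv w @ w) \<in> as_rel Q qop"
    using Cons l by (intro as_rel.cancel word_inv_words) auto
  then show ?case
    using Cons l by (auto simp: word_inv_def intro: as_rel.trans)
qed

lemma group_As: "group G"
proof (rule groupI)
  fix x y assume "x \<in> carrier G" "y \<in> carrier G"
  then show "x \<otimes>\<^bsub>G\<^esub> y \<in> carrier G"
    by (metis append_in_lists_conv carrier_AsE wcl_in wcl_mult)
next
  show "\<one>\<^bsub>G\<^esub> \<in> carrier G"
    by (simp add: one_As wcl_in)
next
  fix x y z assume "x \<in> carrier G" "y \<in> carrier G" "z \<in> carrier G"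
  then show "x \<otimes>\<^bsub>G\<^esub> y \<otimes>\<^bsub>G\<^esub> z = x \<otimes>\<^bsub>G\<^esub> (y \<otimes>\<^bsub>G\<^esub> z)"
    by (elim carrier_AsE) (simp add: wcl_mult)
next
  fix x assume "x \<in> carrier G"
  then obtain w where w: "w \<in> words Q" "x = wcl w" by (rule carrier_AsE)
  then show "\<one>\<^bsub>G\<^esub> \<otimes>\<^bsub>G\<^esub> x = x"
    by (simp add: one_As wcl_mult)
  have "wcl (word_inv w) \<otimes>\<^bsub>G\<^esub> x = \<one>\<^bsub>G\<^esub>"
    using w word_inv_left[of w] by (simp add: one_As wcl_mult word_inv_words wcl_eq)
  then show "\<exists>y\<in>carrier G. y \<otimes>\<^bsub>G\<^esub> x = \<one>\<^bsub>G\<^esub>"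
    by (rule bexI) (simp add: w word_inv_words wcl_in)
qed

sublocale G: group "As Q qop" by (rule group_As)

definition gen :: "'a \<Rightarrow> 'a word set" where "gen x = wcl [(x, True)]"

lemma gen_in [simp]: "x \<in> Q \<Longrightarrow> gen x \<in> carrier G"
  by (simp add: gen_def wcl_in)

lemma inv_gen:
  assumes "x \<in> Q"
  shows "inv\<^bsub>G\<^esub> (gen x) = wcl [(x, False)]"
proof -
  have "wcl [(x, False)] \<otimes>\<^bsub>G\<^esub> gen x = \<one>\<^bsub>G\<^esub>"
    using assms as_rel.cancel[of "[]" Q "[]" x False qop]
    by (simp add: gen_def wcl_mult one_As wcl_eq)
  then show ?thesis
    using assms by (intro G.inv_equality) (auto intro: wcl_in)
qed

lemma gen_qop:
  assumes "x \<in> Q" "y \<in> Q"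
  shows "gen (qop x y) = inv\<^bsub>G\<^esub> (gen y) \<otimes>\<^bsub>G\<^esub> gen x \<otimes>\<^bsub>G\<^esub> gen y"
  using assms as_rel.rel[of "[]" Q "[]" x y qop]
  by (simp add: inv_gen, simp add: gen_def wcl_mult wcl_eq qop_closed)

lemma wcl_Cons:
  assumes "x \<in> Q" "w \<in> words Q"
  shows "wcl ((x, b) # w) = (if b then gen x else inv\<^bsub>G\<^esub> (gen x)) \<otimes>\<^bsub>G\<^esub> wcl w"
  using assms by (simp add: inv_gen, simp add: gen_def wcl_mult)

lemma As_induct [consumes 1, case_names one gen inv_gen]:
  assumes "g \<in> carrier G" "P \<one>\<^bsub>G\<^esub>"
    and "\<And>x g. x \<in> Q \<Longrightarrow> g \<in> carrier G \<Longrightarrow> P g \<Longrightarrow> P (gen x \<otimes>\<^bsub>G\<^esub> g)"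
    and "\<And>x g. x \<in> Q \<Longrightarrow> g \<in> carrier G \<Longrightarrow> P g \<Longrightarrow> P (inv\<^bsub>G\<^esub> (gen x) \<otimes>\<^bsub>G\<^esub> g)"
  shows "P g"
proof -
  have "P (wcl w)" if "w \<in> words Q" for w
    using that
  proof (induction w)
    case Nil
    then show ?case using assms(2) by (simp add: one_As)
  next
    case (Cons l w)
    obtain x b where l: "l = (x, b)" by force
    with Cons assms(3,4)[of x "wcl w"] wcl_in show ?case
      by (auto simp: wcl_Cons)
  qed
  then show ?thesis
    by (metis assms(1) carrier_AsE)
qed

lemma hom_eq_on_gen:
  assumes "h \<in> hom G H" "h' \<in> hom G H" "group H" "\<And>x. x \<in> Q \<Longrightarrow> h (gen x) = h' (gen x)"
    and "g \<in> carrier G"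
  shows "h g = h' g"
proof -
  interpret H: group H by fact
  interpret h: group_hom G H h by (intro group_hom.intro group_hom_axioms.intro assms group_As)
  interpret h': group_hom G H h' by (intro group_hom.intro group_hom_axioms.intro assms group_As)
  show ?thesis
    using assms(5) by (induction rule: As_induct) (simp_all add: assms(4))
qed

primrec word_eval :: "('h, 'b) monoid_scheme \<Rightarrow> ('a \<Rightarrow> 'h) \<Rightarrow> 'a word \<Rightarrow> 'h" where
  "word_eval H \<phi> [] = \<one>\<^bsub>H\<^esub>"
| "word_eval H \<phi> (l # w) = (if snd l then \<phi> (fst l) else inv\<^bsub>H\<^esub> (\<phi> (fst l))) \<otimes>\<^bsub>H\<^esub> word_eval H \<phi> w"

text \<open>Evaluation of words respects cancellation and the defining relation. The two
  homomorphisms prescribed on generators below, the splitting of an extension and the degree, come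
  from here.\<close>

lemma As_universal:
  assumes "group H" and \<phi>: "\<And>x. x \<in> Q \<Longrightarrow> \<phi> x \<in> carrier H"
    and rel: "\<And>x y. x \<in> Q \<Longrightarrow> y \<in> Q \<Longrightarrow> \<phi> (qop x y) = inv\<^bsub>H\<^esub> (\<phi> y) \<otimes>\<^bsub>H\<^esub> \<phi> x \<otimes>\<^bsub>H\<^esub> \<phi> y"
  obtains h where "h \<in> hom G H" "\<And>x. x \<in> Q \<Longrightarrow> h (gen x) = \<phi> x"
proof -
  interpret H: group H by fact
  let ?ev = "word_eval H \<phi>"
  have ev_in: "?ev w \<in> carrier H" if "w \<in> words Q" for w
    using that by (induction w) (simp_all add: mem_Times_iff \<phi>)
  have ev_append: "?ev (u @ v) = ?ev u \<otimes>\<^bsub>H\<^esub> ?ev v" if "u \<in> words Q" "v \<in> words Q" for u v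
    using that by (induction u) (simp_all add: mem_Times_iff \<phi> ev_in H.m_assoc)
  have ev_rel: "?ev u = ?ev v" if "(u, v) \<in> as_rel Q qop" for u v
    using that
  proof (induction rule: as_rel.induct)
    case (cancel u v x b)
    then show ?case
      by (cases b) (simp_all add: ev_append ev_in \<phi> H.m_assoc[symmetric])
  next
    case (rel u v x y)
    then show ?case
      by (simp add: ev_append ev_in \<phi> qop_closed assms(3) H.m_assoc)
  qed auto
  define h where "h g = ?ev (SOME w. w \<in> g)" for g
  have h_wcl: "h (wcl w) = ?ev w" if "w \<in> words Q" for w
  proof -
    have "w \<in> wcl w" using that by (auto intro: as_rel.refl)
    then have "(SOME w'. w' \<in> wcl w) \<in> wcl w" by (rule someI)
    then show ?thesis using ev_rel unfolding h_def by auto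
  qed
  have "h \<in> hom G H"
    by (rule homI; elim carrier_AsE; hypsubst) (simp_all add: h_wcl ev_in wcl_mult ev_append)
  moreover have "h (gen x) = \<phi> x" if "x \<in> Q" for x
    using that by (simp add: gen_def h_wcl \<phi>)
  ultimately show ?thesis by (rule that)
qed

section \<open>The action on X and the inner automorphism group\<close>

lemma word_act_in:
  "x \<in> Q \<Longrightarrow> w \<in> words Q \<Longrightarrow> word_act Q qop x w \<in> Q"
proof (induction w arbitrary: x)
  case (Cons l w)
  obtain y b where l: "l = (y, b)" by force
  show ?case
    using Cons l qop_closed bij_betw_the_inv_into[OF qop_bij[of y], THEN bij_betwE]
    by (cases b) auto
qed auto

lemma word_act_append:
  "word_act Q qop x (u @ v) = word_act Q qop (word_act Q qop x u) v"
  by (induction Q qop x u rule: word_act.induct) auto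

lemma qop_inv:
  assumes "x \<in> Q" "y \<in> Q"
  shows "qop (the_inv_into Q (\<lambda>z. qop z y) x) y = x"
    "the_inv_into Q (\<lambda>z. qop z y) (qop x y) = x"
  using assms f_the_inv_into_f_bij_betw[OF qop_bij, of y x] the_inv_into_f_f[of "\<lambda>z. qop z y" Q x]
    qop_bij[of y] by (auto simp: bij_betw_def)

lemma word_act_rel:
  "(u, v) \<in> as_rel Q qop \<Longrightarrow> x \<in> Q \<Longrightarrow> word_act Q qop x u = word_act Q qop x v"
proof (induction arbitrary: x rule: as_rel.induct)
  case (cancel u v y b)
  then show ?case
    by (cases b) (auto simp: word_act_append qop_inv word_act_in)
next
  case (rel u v z y)
  define p where "p = word_act Q qop x u"
  define q where "q = the_inv_into Q (\<lambda>z. qop z y) p"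
  have p: "p \<in> Q" using rel by (simp add: p_def word_act_in)
  have q: "q \<in> Q" using p rel word_act_in[of p "[(y, False)]"] by (simp add: q_def)
  have "qop q y = p" using p rel by (simp add: q_def qop_inv)
  \<comment> \<open>Self-distributivity is what makes the letter \<open>qop z y\<close> and the word
    e_y^{-1} e_z e_y act alike.\<close>
  then have "qop p (qop z y) = qop (qop q z) y"
    using q rel by (metis qop_distrib)
  then show ?case
    using rel by (simp add: word_act_append p_def[symmetric] q_def[symmetric])
qed auto

lemma psi_wcl:
  assumes "w \<in> words Q"
  shows "psi Q qop (wcl w) = (\<lambda>x\<in>Q. word_act Q qop x w)"
proof -
  have "w \<in> wcl w" using assms by (auto intro: as_rel.refl)
  then have "(SOME w'. w' \<in> wcl w) \<in> wcl w" by (rule someI)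
  then show ?thesis unfolding psi_def by (auto simp: word_act_rel[symmetric])
qed

text \<open>The action is on the right, while \<open>BijGroup\<close> composes on the left.\<close>

lemma psi_mult:
  assumes "g \<in> carrier G" "h \<in> carrier G"
  shows "psi Q qop (g \<otimes>\<^bsub>G\<^esub> h) = compose Q (psi Q qop h) (psi Q qop g)"
  using assms
  by (elim carrier_AsE; hypsubst)
     (simp add: wcl_mult psi_wcl word_act_append word_act_in compose_def restrict_def fun_eq_iff)

lemma psi_one: "psi Q qop \<one>\<^bsub>G\<^esub> = (\<lambda>x\<in>Q. x)"
  by (simp add: one_As psi_wcl)

lemma psi_Bij:
  assumes "g \<in> carrier G"
  shows "psi Q qop g \<in> Bij Q"
proof -
  have ext: "psi Q qop g \<in> Q \<rightarrow>\<^sub>E Q" if "g \<in> carrier G" for g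
    using that by (elim carrier_AsE; hypsubst) (simp add: psi_wcl word_act_in)
  have inv: "psi Q qop (inv\<^bsub>G\<^esub> g) (psi Q qop g x) = x" if "g \<in> carrier G" "x \<in> Q" for g x
    using that psi_mult[of g "inv\<^bsub>G\<^esub> g"] psi_one
    by (metis G.inv_closed G.r_inv compose_eq restrict_apply')
  have "bij_betw (psi Q qop g) Q Q"
    using inv[OF assms] inv[of "inv\<^bsub>G\<^esub> g"] ext[OF assms] ext[of "inv\<^bsub>G\<^esub> g"] assms
    by (intro bij_betw_byWitness[where f' = "psi Q qop (inv\<^bsub>G\<^esub> g)"]) auto
  then show ?thesis
    using ext[OF assms] by (auto simp: Bij_def PiE_def)
qed

text \<open>Inversion turns the antihomomorphism \<open>psi\<close> into a homomorphism to
  \<open>BijGroup\<close> with the same image (\<open>Inn_eq\<close>) and the same kernel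
  (\<open>carrier_Ker_psi\<close>).\<close>

definition pr :: "'a word set \<Rightarrow> 'a \<Rightarrow> 'a" where "pr g = psi Q qop (inv\<^bsub>G\<^esub> g)"

lemma pr_hom_Bij: "pr \<in> hom G (BijGroup Q)"
  by (rule homI) (auto simp: pr_def BijGroup_def psi_Bij psi_mult G.inv_mult_group)

lemma Inn_eq: "Inn Q qop = (BijGroup Q)\<lparr>carrier := pr ` carrier G\<rparr>"
proof -
  have "pr g \<in> psi Q qop ` carrier G" if "g \<in> carrier G" for g
    unfolding pr_def by (rule imageI) (simp add: that)
  moreover have "psi Q qop g \<in> pr ` carrier G" if "g \<in> carrier G" for g
    using that by (intro image_eqI[where x = "inv\<^bsub>G\<^esub> g"]) (simp_all add: pr_def)
  ultimately have "pr ` carrier G = psi Q qop ` carrier G"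
    by blast
  then show ?thesis by (simp add: Inn_def)
qed

lemma group_Inn: "group (Inn Q qop)"
proof -
  interpret p: group_hom G "BijGroup Q" pr
    by (intro group_hom.intro group_hom_axioms.intro group_As group_BijGroup pr_hom_Bij)
  show ?thesis
    unfolding Inn_eq using p.img_is_subgroup group.subgroup_imp_group[OF group_BijGroup] by blast
qed

lemma pr_hom: "pr \<in> hom G (Inn Q qop)"
  using pr_hom_Bij by (auto simp: Inn_eq hom_def)

lemma pr_surj: "pr ` carrier G = carrier (Inn Q qop)"
  by (simp add: Inn_eq)

lemma carrier_Ker_psi: "carrier (Ker_psi Q qop) = {g \<in> carrier G. pr g = \<one>\<^bsub>Inn Q qop\<^esub>}"
proof -
  interpret p: group_hom G "Inn Q qop" pr
    by (intro group_hom.intro group_hom_axioms.intro group_As group_Inn pr_hom)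
  have one: "\<one>\<^bsub>Inn Q qop\<^esub> = (\<lambda>x\<in>Q. x)"
    by (simp add: Inn_def BijGroup_def)
  have "pr g = \<one>\<^bsub>Inn Q qop\<^esub> \<longleftrightarrow> psi Q qop g = (\<lambda>x\<in>Q. x)" if "g \<in> carrier G" for g
  proof -
    have "pr g = \<one>\<^bsub>Inn Q qop\<^esub> \<longleftrightarrow> pr (inv\<^bsub>G\<^esub> g) = \<one>\<^bsub>Inn Q qop\<^esub>"
      using that by (simp add: p.H.inv_eq_1_iff)
    also have "pr (inv\<^bsub>G\<^esub> g) = psi Q qop g"
      using that by (simp add: pr_def)
    finally show ?thesis unfolding one .
  qed
  then show ?thesis by (auto simp: Ker_psi_def)
qed

end

section \<open>The universal 2-cocycle\<close>

definition cocycle :: "('g, 'c) monoid_scheme \<Rightarrow> ('b, 'd) monoid_scheme \<Rightarrow> ('g \<Rightarrow> 'g \<Rightarrow> 'b) \<Rightarrow> bool" where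
  "cocycle N B f \<longleftrightarrow>
     (\<forall>x\<in>carrier N. \<forall>y\<in>carrier N. f x y \<in> carrier B) \<and>
     (\<forall>x\<in>carrier N. \<forall>y\<in>carrier N. \<forall>z\<in>carrier N.
        f x y \<otimes>\<^bsub>B\<^esub> f (x \<otimes>\<^bsub>N\<^esub> y) z = f y z \<otimes>\<^bsub>B\<^esub> f x (y \<otimes>\<^bsub>N\<^esub> z))"

definition single :: "'g list \<Rightarrow> 'g list \<Rightarrow> int" where
  "single xs = (\<lambda>ys. if ys = xs then 1 else 0)"

text \<open>Linear extension of \<phi> from the basis of tuples to chains, written multiplicatively
  in \<open>A\<close>.\<close>

definition lift :: "('b, 'd) monoid_scheme \<Rightarrow> ('g list \<Rightarrow> 'b) \<Rightarrow> ('g list \<Rightarrow> int) \<Rightarrow> 'b" where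
  "lift A \<phi> c = finprod A (\<lambda>xs. \<phi> xs [^]\<^bsub>A\<^esub> c xs) {xs. c xs \<noteq> 0}"

section \<open>Chain groups as free abelian groups on tuples\<close>

lemma chain_group_simps [simp]:
  "carrier (chain_group N n) = chains N n"
  "a \<otimes>\<^bsub>chain_group N n\<^esub> b = (\<lambda>xs. a xs + b xs)"
  "\<one>\<^bsub>chain_group N n\<^esub> = (\<lambda>_. 0)"
  by (simp_all add: chain_group_def)

lemma chains_add: "a \<in> chains N n \<Longrightarrow> b \<in> chains N n \<Longrightarrow> (\<lambda>xs. a xs + b xs) \<in> chains N n"
proof -
  assume ab: "a \<in> chains N n" "b \<in> chains N n"
  have "finite ({xs. a xs \<noteq> 0} \<union> {xs. b xs \<noteq> 0})"
    using ab by (simp add: chains_def)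
  then have "finite {xs. a xs + b xs \<noteq> 0}"
    by (rule finite_subset[rotated]) auto
  moreover have "length xs = n \<and> set xs \<subseteq> carrier N" if "a xs + b xs \<noteq> 0" for xs
  proof -
    have "a xs \<noteq> 0 \<or> b xs \<noteq> 0" using that by auto
    then show ?thesis using ab by (auto simp: chains_def)
  qed
  ultimately show ?thesis by (simp add: chains_def)
qed

lemma chains_scale: "a \<in> chains N n \<Longrightarrow> (\<lambda>xs. k * a xs) \<in> chains N n"
  by (auto simp: chains_def elim!: finite_subset[rotated])

lemma chains_zero [simp]: "(\<lambda>_. 0) \<in> chains N n"
  by (simp add: chains_def)

lemma comm_group_chain_group: "comm_group (chain_group N n)"
proof (rule comm_groupI)
  fix x assume "x \<in> carrier (chain_group N n)"
  then show "\<exists>y\<in>carrier (chain_group N n). y \<otimes>\<^bsub>chain_group N n\<^esub> x = \<one>\<^bsub>chain_group N n\<^esub>"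
    using chains_scale[of x N n "-1"] by (intro bexI[of _ "\<lambda>xs. -1 * x xs"]) auto
qed (auto intro!: chains_add)

lemma group_chain_group: "group (chain_group N n)"
  by (rule comm_group.axioms(2)[OF comm_group_chain_group])

lemma inv_chain_group:
  assumes "a \<in> chains N n"
  shows "inv\<^bsub>chain_group N n\<^esub> a = (\<lambda>xs. - a xs)"
proof -
  interpret C: comm_group "chain_group N n" by (rule comm_group_chain_group)
  show ?thesis
    using assms chains_scale[of a N n "-1"] by (intro C.inv_equality) auto
qed

lemma int_pow_chain_group:
  assumes "a \<in> chains N n"
  shows "a [^]\<^bsub>chain_group N n\<^esub> (k::int) = (\<lambda>xs. k * a xs)"
proof -
  interpret C: comm_group "chain_group N n" by (rule comm_group_chain_group)
  have nat: "a [^]\<^bsub>chain_group N n\<^esub> (m::nat) = (\<lambda>xs. int m * a xs)" for m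
    by (induction m) (auto simp: algebra_simps)
  show ?thesis
    using inv_chain_group[OF chains_scale[OF assms, of "- k"]]
    by (auto simp: int_pow_def2 nat)
qed

lemma single_chain: "length xs = n \<Longrightarrow> set xs \<subseteq> carrier N \<Longrightarrow> single xs \<in> chains N n"
  by (auto simp: chains_def single_def)

lemma chain_hom_eqI:
  assumes h: "h \<in> hom (chain_group N n) B" "h' \<in> hom (chain_group N n) B" and "group B"
    and eq: "\<And>xs. length xs = n \<Longrightarrow> set xs \<subseteq> carrier N \<Longrightarrow> h (single xs) = h' (single xs)"
    and c: "c \<in> chains N n"
  shows "h c = h' c"
proof -
  interpret C: comm_group "chain_group N n" by (rule comm_group_chain_group)
  interpret h: group_hom "chain_group N n" B h
    using assms by (intro group_hom.intro group_hom_axioms.intro) (auto intro: C.is_group)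
  interpret h': group_hom "chain_group N n" B h'
    using assms by (intro group_hom.intro group_hom_axioms.intro) (auto intro: C.is_group)
  \<comment> \<open>Induction over a finite superset of the support: deleting a tuple from the
    superset always leaves a chain covered by the induction hypothesis, whether or not the tuple
    lies in the support.\<close>
  have "h c = h' c" if "finite S" "{xs. c xs \<noteq> 0} \<subseteq> S" "c \<in> chains N n" for S c
    using that
  proof (induction S arbitrary: c)
    case empty
    then have "c = \<one>\<^bsub>chain_group N n\<^esub>" by auto
    then show ?case using h.hom_one h'.hom_one by simp
  next
    case (insert xs S)
    show ?case
    proof (cases "c xs = 0")
      case True
      then show ?thesis using insert by (intro insert.IH) auto
    next
      case False
      then have xs: "length xs = n" "set xs \<subseteq> carrier N"
        using insert.prems by (auto simp: chains_def)
      define d where "d = c(xs := 0)"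
      have d: "d \<in> chains N n"
        using insert.prems(2) unfolding chains_def d_def
        by (auto elim!: finite_subset[rotated])
      have s: "single xs \<in> chains N n" using xs by (rule single_chain)
      have "c = d \<otimes>\<^bsub>chain_group N n\<^esub> (single xs [^]\<^bsub>chain_group N n\<^esub> c xs)"
        by (auto simp: int_pow_chain_group[OF s]) (auto simp: d_def single_def)
      moreover have "h d = h' d"
      proof (rule insert.IH)
        show "{xs. d xs \<noteq> 0} \<subseteq> S" using insert.prems by (auto simp: d_def)
      qed (rule d)
      moreover have "single xs [^]\<^bsub>chain_group N n\<^esub> c xs \<in> carrier (chain_group N n)"
        using s by (intro C.int_pow_closed) simp
      moreover have "h (single xs [^]\<^bsub>chain_group N n\<^esub> c xs) = h' (single xs [^]\<^bsub>chain_group N n\<^esub> c xs)"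
        using s eq[OF xs] by (simp only: h.hom_int_pow h'.hom_int_pow chain_group_simps)
      ultimately show ?thesis
        using d h.hom_mult[of d "single xs [^]\<^bsub>chain_group N n\<^esub> c xs"]
          h'.hom_mult[of d "single xs [^]\<^bsub>chain_group N n\<^esub> c xs"]
        by (metis chain_group_simps(1))
    qed
  qed
  from this[of "{xs. c xs \<noteq> 0}" c] c show ?thesis by (simp add: chains_def)
qed

lemma lift_hom:
  assumes "comm_group A"
    and \<phi>: "\<And>xs. length xs = n \<Longrightarrow> set xs \<subseteq> carrier N \<Longrightarrow> \<phi> xs \<in> carrier A"
  shows "lift A \<phi> \<in> hom (chain_group N n) A"
proof -
  interpret A: comm_group A by fact
  have pi: "\<phi> xs [^]\<^bsub>A\<^esub> c xs \<in> carrier A" if "c \<in> chains N n" for c xs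
    using that \<phi> by (cases "c xs = 0") (auto simp: chains_def)
  \<comment> \<open>Cancellation can make the support of a sum smaller than the union of the
    supports, so all products are taken over one common finite set.\<close>
  have sup: "lift A \<phi> c = finprod A (\<lambda>xs. \<phi> xs [^]\<^bsub>A\<^esub> c xs) S"
    if "finite S" "{xs. c xs \<noteq> 0} \<subseteq> S" "c \<in> chains N n" for c S
    unfolding lift_def
    by (rule A.finprod_mono_neutral_cong_left) (use that pi in auto)
  show ?thesis
  proof (rule homI)
    fix c assume "c \<in> carrier (chain_group N n)"
    then show "lift A \<phi> c \<in> carrier A"
      unfolding lift_def by (intro A.finprod_closed) (auto simp: pi)
  next
    fix c d assume cd: "c \<in> carrier (chain_group N n)" "d \<in> carrier (chain_group N n)"
    let ?S = "{xs. c xs \<noteq> 0} \<union> {xs. d xs \<noteq> 0}"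
    have S: "finite ?S" using cd by (auto simp: chains_def)
    have "lift A \<phi> (\<lambda>xs. c xs + d xs) = finprod A (\<lambda>xs. \<phi> xs [^]\<^bsub>A\<^esub> (c xs + d xs)) ?S"
      using S cd by (intro sup chains_add) auto
    also have "\<dots> = finprod A (\<lambda>xs. \<phi> xs [^]\<^bsub>A\<^esub> c xs \<otimes>\<^bsub>A\<^esub> \<phi> xs [^]\<^bsub>A\<^esub> d xs) ?S"
    proof (rule A.finprod_cong')
      fix xs assume "xs \<in> ?S"
      then have "\<phi> xs \<in> carrier A" using cd \<phi> by (auto simp: chains_def)
      then show "\<phi> xs [^]\<^bsub>A\<^esub> (c xs + d xs) = \<phi> xs [^]\<^bsub>A\<^esub> c xs \<otimes>\<^bsub>A\<^esub> \<phi> xs [^]\<^bsub>A\<^esub> d xs"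
        by (simp add: A.int_pow_mult)
    qed (use cd pi in auto)
    also have "\<dots> = finprod A (\<lambda>xs. \<phi> xs [^]\<^bsub>A\<^esub> c xs) ?S \<otimes>\<^bsub>A\<^esub> finprod A (\<lambda>xs. \<phi> xs [^]\<^bsub>A\<^esub> d xs) ?S"
      using cd pi by (intro A.finprod_multf) auto
    also have "\<dots> = lift A \<phi> c \<otimes>\<^bsub>A\<^esub> lift A \<phi> d"
      using S cd sup[of ?S c] sup[of ?S d] by auto
    finally show "lift A \<phi> (c \<otimes>\<^bsub>chain_group N n\<^esub> d) = lift A \<phi> c \<otimes>\<^bsub>A\<^esub> lift A \<phi> d"
      by simp
  qed
qed

lemma lift_single:
  assumes "comm_group A" "\<phi> xs \<in> carrier A"
  shows "lift A \<phi> (single xs) = \<phi> xs"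
proof -
  interpret A: comm_group A by fact
  have eq: "{ys. single xs ys \<noteq> 0} = {xs}" by (auto simp: single_def)
  show ?thesis
    unfolding lift_def eq using assms(2) by (simp add: single_def)
qed

lemma face_valid:
  assumes "length xs = Suc n" "set xs \<subseteq> carrier N" "i \<le> length xs" "group N"
  shows "length (face N i xs) = n \<and> set (face N i xs) \<subseteq> carrier N"
proof -
  interpret N: group N by fact
  show ?thesis
  proof (cases "i = 0 \<or> i = length xs")
    case True
    then show ?thesis
      using assms by (auto simp: face_def dest: in_set_butlastD list.set_sel(2)[rotated])
  next
    case False
    then have i: "0 < i" "i < length xs" using assms by auto
    have "xs ! (i - 1) \<in> carrier N" "xs ! i \<in> carrier N"
      using i assms(2) by (auto simp: subset_iff)
    then show ?thesis
      using i False assms(1,2)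
      by (auto simp: face_def dest!: in_set_takeD in_set_dropD)
  qed
qed

lemma bd_basis_eq: "bd_basis N xs ys = (\<Sum>i\<le>length xs. (-1) ^ i * single (face N i xs) ys)"
  unfolding bd_basis_def single_def by (intro sum.cong) auto

lemma bd_basis_chain:
  assumes "length xs = Suc n" "set xs \<subseteq> carrier N" "group N"
  shows "bd_basis N xs \<in> chains N n"
proof -
  have "(\<lambda>ys. \<Sum>i\<in>I. (-1) ^ i * single (face N i xs) ys) \<in> chains N n"
    if "finite I" "I \<subseteq> {..length xs}" for I
    using that
    by (induction I)
       (auto intro!: chains_add chains_scale single_chain dest: face_valid[OF assms(1,2) _ assms(3)])
  from this[of "{..length xs}"] show ?thesis
    by (simp add: bd_basis_eq[abs_def])
qed

lemma boundary_superset: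
  assumes "finite S" "{xs. c xs \<noteq> 0} \<subseteq> S"
  shows "boundary N c ys = (\<Sum>xs\<in>S. c xs * bd_basis N xs ys)"
  unfolding boundary_def by (rule sum.mono_neutral_left) (use assms in auto)

lemma boundary_add:
  assumes "c \<in> chains N n" "d \<in> chains N n"
  shows "boundary N (\<lambda>xs. c xs + d xs) = (\<lambda>ys. boundary N c ys + boundary N d ys)"
proof
  fix ys
  let ?S = "{xs. c xs \<noteq> 0} \<union> {xs. d xs \<noteq> 0}"
  have S: "finite ?S" using assms by (auto simp: chains_def)
  have "boundary N (\<lambda>xs. c xs + d xs) ys = (\<Sum>xs\<in>?S. (c xs + d xs) * bd_basis N xs ys)"
    by (rule boundary_superset) (use S in auto)
  also have "\<dots> = boundary N c ys + boundary N d ys"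
    using boundary_superset[OF S, of c N ys] boundary_superset[OF S, of d N ys]
    by (auto simp: sum.distrib distrib_right)
  finally show "boundary N (\<lambda>xs. c xs + d xs) ys = boundary N c ys + boundary N d ys" .
qed

lemma boundary_single: "boundary N (single xs) = bd_basis N xs"
proof -
  have "{ys. single xs ys \<noteq> 0} = {xs}" by (auto simp: single_def)
  then show ?thesis unfolding boundary_def by (simp add: single_def)
qed

lemma boundary_hom:
  assumes "group N"
  shows "boundary N \<in> hom (chain_group N (Suc n)) (chain_group N n)"
proof (rule homI)
  fix c assume "c \<in> carrier (chain_group N (Suc n))"
  then have c: "c \<in> chains N (Suc n)" by simp
  have "(\<lambda>ys. \<Sum>xs\<in>S. c xs * bd_basis N xs ys) \<in> chains N n"
    if "finite S" "S \<subseteq> {xs. c xs \<noteq> 0}" for S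
    using that
  proof (induction S)
    case (insert xs S)
    then have "bd_basis N xs \<in> chains N n"
      using c assms by (intro bd_basis_chain) (auto simp: chains_def)
    with insert show ?case by (auto intro!: chains_add chains_scale)
  qed simp
  from this[of "{xs. c xs \<noteq> 0}"] show "boundary N c \<in> carrier (chain_group N n)"
    using c by (simp add: boundary_def[abs_def] chains_def)
qed (auto simp: boundary_add)

lemma bd_basis_2:
  "bd_basis N [x, y] = (\<lambda>zs. single [y] zs - single [x \<otimes>\<^bsub>N\<^esub> y] zs + single [x] zs)"
  by (rule ext) (simp add: bd_basis_eq face_def numeral_2_eq_2)

lemma bd_basis_3:
  "bd_basis N [x, y, z] = (\<lambda>zs. single [y, z] zs - single [x \<otimes>\<^bsub>N\<^esub> y, z] zs
      + single [x, y \<otimes>\<^bsub>N\<^esub> z] zs - single [x, y] zs)"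
  by (rule ext) (simp add: bd_basis_eq face_def numeral_eq_Suc)

lemma boundary_uminus: "boundary N (\<lambda>xs. - c xs) = (\<lambda>ys. - boundary N c ys)"
  by (rule ext) (simp add: boundary_def sum_negf)

lemma boundary_diff:
  assumes "c \<in> chains N n" "d \<in> chains N n"
  shows "boundary N (\<lambda>xs. c xs - d xs) = (\<lambda>ys. boundary N c ys - boundary N d ys)"
  using boundary_add[OF assms(1), of "\<lambda>xs. - d xs"] chains_scale[OF assms(2), of "-1"]
  by (simp add: boundary_uminus)

lemma length_2E:
  assumes "length xs = 2"
  obtains x y where "xs = [x, y]"
  using assms by (auto simp: numeral_2_eq_2 length_Suc_conv)

lemma length_3E:
  assumes "length xs = 3"
  obtains x y z where "xs = [x, y, z]"
  using assms by (auto simp: numeral_3_eq_3 length_Suc_conv)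

section \<open>The quotient C_2/B_2, its universal cocycle and H_2\<close>

locale bar_complex = group N for N :: "('g, 'c) monoid_scheme" (structure)
begin

lemma chains_diff: "a \<in> chains N n \<Longrightarrow> b \<in> chains N n \<Longrightarrow> (\<lambda>xs. a xs - b xs) \<in> chains N n"
  using chains_add[of a N n "\<lambda>xs. -1 * b xs"] chains_scale[of b N n "-1"] by simp

lemma boundary_single_2: "boundary N (single [x, y]) = (\<lambda>zs. single [y] zs - single [x \<otimes> y] zs + single [x] zs)"
  by (simp add: boundary_single bd_basis_2)

lemma boundary_boundary:
  assumes "c \<in> chains N 3"
  shows "boundary N (boundary N c) = (\<lambda>_. 0)"
proof -
  interpret C1: comm_group "chain_group N 1" by (rule comm_group_chain_group)
  have b3: "boundary N \<in> hom (chain_group N 3) (chain_group N 2)"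
    and b2: "boundary N \<in> hom (chain_group N 2) (chain_group N 1)"
    using boundary_hom[OF is_group, of 2] boundary_hom[OF is_group, of 1]
    by (simp_all add: numeral_eq_Suc)
  have "(boundary N \<circ> boundary N) c = (\<lambda>_. \<one>\<^bsub>chain_group N 1\<^esub>) c"
  proof (rule chain_hom_eqI[of "boundary N \<circ> boundary N" N 3 "chain_group N 1" "\<lambda>_. \<one>\<^bsub>chain_group N 1\<^esub>"])
    show "boundary N \<circ> boundary N \<in> hom (chain_group N 3) (chain_group N 1)"
      using b3 b2 by (rule Group.hom_compose)
    show "(\<lambda>_. \<one>\<^bsub>chain_group N 1\<^esub>) \<in> hom (chain_group N 3) (chain_group N 1)"
      by (auto simp: hom_def)
    show "c \<in> chains N 3" by fact
    fix xs assume xs: "length xs = 3" "set xs \<subseteq> carrier N"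
    from xs(1) obtain x y z where xyz: "xs = [x, y, z]" by (rule length_3E)
    have c: "x \<in> carrier N" "y \<in> carrier N" "z \<in> carrier N" using xs xyz by auto
    then have s: "single [y, z] \<in> chains N 2" "single [x \<otimes> y, z] \<in> chains N 2"
      "single [x, y \<otimes> z] \<in> chains N 2" "single [x, y] \<in> chains N 2"
      by (auto intro!: single_chain)
    \<comment> \<open>The terms of the expanded double boundary cancel in pairs; associativity
      identifies [(xy)z] with [x(yz)].\<close>
    show "(boundary N \<circ> boundary N) (single xs) = \<one>\<^bsub>chain_group N 1\<^esub>"
      using c unfolding xyz comp_def boundary_single bd_basis_3
      by (simp add: boundary_add[of _ N 2] boundary_diff[of _ N 2] s chains_diff chains_add
          boundary_single_2 m_assoc)
  qed (rule C1.is_group)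
  then show ?thesis by simp
qed

definition C2 where "C2 = chain_group N 2"
definition B2 where "B2 = boundaries N 2"
text \<open>All of C_2 is divided by B_2, not only the cycles: a single pair [x, y] is never a
  cycle, yet its class must be a value of the universal cocycle \<open>u\<close>.\<close>

definition A2 where "A2 = C2 Mod B2"
definition u where "u x y = B2 #>\<^bsub>C2\<^esub> single [x, y]"

sublocale C2: comm_group C2 unfolding C2_def by (rule comm_group_chain_group)

lemma B2_subgroup: "subgroup B2 C2"
proof -
  have "boundary N \<in> hom (chain_group N 3) (chain_group N 2)"
    using boundary_hom[OF is_group, of 2] by (simp add: numeral_eq_Suc)
  then interpret b: group_hom "chain_group N 3" "chain_group N 2" "boundary N"
    using comm_group_chain_group
    by (intro group_hom.intro group_hom_axioms.intro) (auto intro: comm_group.axioms)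
  show ?thesis
    using b.img_is_subgroup by (simp add: B2_def C2_def boundaries_def numeral_eq_Suc)
qed

lemma B2_normal: "B2 \<lhd> C2"
  by (rule C2.subgroup_imp_normal[OF B2_subgroup])

lemma comm_group_A2: "comm_group A2"
  unfolding A2_def by (rule C2.abelian_FactGroup[OF B2_subgroup])

sublocale A2: comm_group A2 by (rule comm_group_A2)

lemma single_2: "x \<in> carrier N \<Longrightarrow> y \<in> carrier N \<Longrightarrow> single [x, y] \<in> carrier C2"
  by (simp add: C2_def single_chain)

lemma u_in: "x \<in> carrier N \<Longrightarrow> y \<in> carrier N \<Longrightarrow> u x y \<in> carrier A2"
  by (auto simp: A2_def u_def carrier_FactGroup single_2)

lemma proj_hom: "(\<lambda>c. B2 #>\<^bsub>C2\<^esub> c) \<in> hom C2 A2"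
  unfolding A2_def by (rule normal.r_coset_hom_Mod[OF B2_normal])

lemma A2_hom_eqI:
  assumes h: "h \<in> hom A2 B" "h' \<in> hom A2 B" and "group B"
    and eq: "\<And>x y. x \<in> carrier N \<Longrightarrow> y \<in> carrier N \<Longrightarrow> h (u x y) = h' (u x y)"
    and a: "a \<in> carrier A2"
  shows "h a = h' a"
proof -
  obtain c where c: "c \<in> carrier C2" "a = B2 #>\<^bsub>C2\<^esub> c"
    using a by (auto simp: A2_def carrier_FactGroup)
  have "(h \<circ> (\<lambda>c. B2 #>\<^bsub>C2\<^esub> c)) c = (h' \<circ> (\<lambda>c. B2 #>\<^bsub>C2\<^esub> c)) c"
  proof (rule chain_hom_eqI[of "h \<circ> (\<lambda>c. B2 #>\<^bsub>C2\<^esub> c)" N 2 B "h' \<circ> (\<lambda>c. B2 #>\<^bsub>C2\<^esub> c)"])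
    fix xs assume "length xs = 2" "set xs \<subseteq> carrier N"
    then obtain x y where "xs = [x, y]" "x \<in> carrier N" "y \<in> carrier N"
      by (auto elim!: length_2E)
    then show "(h \<circ> (\<lambda>c. B2 #>\<^bsub>C2\<^esub> c)) (single xs) = (h' \<circ> (\<lambda>c. B2 #>\<^bsub>C2\<^esub> c)) (single xs)"
      using eq by (simp add: u_def)
  qed (use h c proj_hom assms(3) in \<open>auto simp: C2_def[symmetric] simp flip: chain_group_simps(1) intro: Group.hom_compose\<close>)
  then show ?thesis by (simp add: c)
qed

text \<open>The chain identity d[x,y,z] + [x,y] + [xy,z] = [y,z] + [x,yz], mapped by
  \<open>h\<close>. It is read in both directions: killing boundaries gives the cocycle identity
  (\<open>u_cocycle\<close>), and the cocycle identity makes boundaries vanish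
  (\<open>A2_universal\<close>).\<close>

lemma hom_C2_cocycle:
  assumes h: "h \<in> hom C2 B" "comm_group B"
    and xyz: "x \<in> carrier N" "y \<in> carrier N" "z \<in> carrier N"
  shows "h (boundary N (single [x, y, z])) \<otimes>\<^bsub>B\<^esub> (h (single [x, y]) \<otimes>\<^bsub>B\<^esub> h (single [x \<otimes> y, z]))
     = h (single [y, z]) \<otimes>\<^bsub>B\<^esub> h (single [x, y \<otimes> z])"
proof -
  have b: "boundary N (single [x, y, z]) \<in> carrier C2"
    using boundary_hom[OF is_group, of 2] xyz single_chain[of "[x, y, z]" "Suc 2" N]
    by (auto simp: C2_def hom_def)
  have "boundary N (single [x, y, z]) \<otimes>\<^bsub>C2\<^esub> (single [x, y] \<otimes>\<^bsub>C2\<^esub> single [x \<otimes> y, z])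
     = single [y, z] \<otimes>\<^bsub>C2\<^esub> single [x, y \<otimes> z]"
    by (auto simp: C2_def boundary_single bd_basis_3)
  then show ?thesis
    using b xyz by (simp add: single_2 flip: hom_mult[OF h(1)])
qed

lemma u_cocycle: "cocycle N A2 u"
  unfolding cocycle_def
proof (intro conjI ballI)
  fix x y z assume xyz: "x \<in> carrier N" "y \<in> carrier N" "z \<in> carrier N"
  let ?b = "boundary N (single [x, y, z])"
  have b: "?b \<in> B2"
    using xyz by (auto simp: B2_def boundaries_def intro!: single_chain)
  then have "B2 #>\<^bsub>C2\<^esub> ?b = \<one>\<^bsub>A2\<^esub>"
    by (simp add: A2_def FactGroup_def C2.coset_join2[OF _ B2_subgroup] subgroup.mem_carrier[OF B2_subgroup])
  then show "u x y \<otimes>\<^bsub>A2\<^esub> u (x \<otimes> y) z = u y z \<otimes>\<^bsub>A2\<^esub> u x (y \<otimes> z)"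
    using hom_C2_cocycle[OF proj_hom comm_group_A2 xyz] xyz
    by (simp add: u_def[symmetric] u_in)
qed (rule u_in)

text \<open>The linear extension of \<open>k\<close> to C_2 kills the boundary of each basis 3-chain
  because \<open>k\<close> is a cocycle, hence it descends to C_2/B_2.\<close>

lemma A2_universal:
  assumes "comm_group B" "cocycle N B k"
  obtains \<kappa> where "\<kappa> \<in> hom A2 B"
    "\<And>x y. x \<in> carrier N \<Longrightarrow> y \<in> carrier N \<Longrightarrow> \<kappa> (u x y) = k x y"
proof -
  interpret B: comm_group B by fact
  define h where "h = lift B (\<lambda>xs. k (xs ! 0) (xs ! 1))"
  have k: "k x y \<in> carrier B" if "x \<in> carrier N" "y \<in> carrier N" for x y
    using assms(2) that by (simp add: cocycle_def)
  have h: "h \<in> hom C2 B"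
    unfolding h_def C2_def by (rule lift_hom) (auto intro: assms(1) elim!: length_2E simp: k)
  have h_single: "h (single [x, y]) = k x y" if "x \<in> carrier N" "y \<in> carrier N" for x y
    using lift_single[OF assms(1), of "\<lambda>xs. k (xs ! 0) (xs ! 1)" "[x, y]"] k[OF that]
    by (simp add: h_def)
  interpret h: group_hom C2 B h
    by (intro group_hom.intro group_hom_axioms.intro) (rule h C2.is_group B.is_group)+
  have b: "boundary N \<in> hom (chain_group N 3) C2"
    using boundary_hom[OF is_group, of 2] by (simp add: numeral_eq_Suc C2_def)
  have vanish: "h (boundary N c) = \<one>\<^bsub>B\<^esub>" if "c \<in> chains N 3" for c
  proof -
    have "(h \<circ> boundary N) c = (\<lambda>_. \<one>\<^bsub>B\<^esub>) c"
    proof (rule chain_hom_eqI[of "h \<circ> boundary N" N 3 B "\<lambda>_. \<one>\<^bsub>B\<^esub>"])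
      show "h \<circ> boundary N \<in> hom (chain_group N 3) B" using b h by (rule Group.hom_compose)
      show "(\<lambda>_. \<one>\<^bsub>B\<^esub>) \<in> hom (chain_group N 3) B" by (auto simp: hom_def)
      fix xs assume xs: "length xs = 3" "set xs \<subseteq> carrier N"
      from xs(1) obtain x y z where xyz: "xs = [x, y, z]" by (rule length_3E)
      have c: "x \<in> carrier N" "y \<in> carrier N" "z \<in> carrier N" using xs xyz by auto
      have "boundary N (single xs) \<in> carrier C2"
        using b xs by (auto simp: hom_def single_chain)
      then have hb: "h (boundary N (single xs)) \<in> carrier B" by simp
      have "h (boundary N (single xs)) \<otimes>\<^bsub>B\<^esub> (k x y \<otimes>\<^bsub>B\<^esub> k (x \<otimes> y) z) = k y z \<otimes>\<^bsub>B\<^esub> k x (y \<otimes> z)"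
        using hom_C2_cocycle[OF h assms(1) c] c by (simp add: xyz h_single)
      also have "\<dots> = k x y \<otimes>\<^bsub>B\<^esub> k (x \<otimes> y) z"
        using assms(2) c by (simp add: cocycle_def)
      finally show "(h \<circ> boundary N) (single xs) = \<one>\<^bsub>B\<^esub>"
        using hb c k by (simp add: B.r_cancel_one)
    qed (use that B.is_group in auto)
    then show ?thesis by simp
  qed
  have "B2 \<subseteq> kernel C2 B h"
    using vanish subgroup.mem_carrier[OF B2_subgroup]
    by (auto simp: kernel_def B2_def boundaries_def)
  then obtain \<kappa> where "\<kappa> \<in> hom A2 B" "\<And>c. c \<in> carrier C2 \<Longrightarrow> \<kappa> (B2 #>\<^bsub>C2\<^esub> c) = h c"
    using h.FactGroup_universal_kernel[OF B2_normal] unfolding A2_def by blast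
  then show ?thesis
    using that h_single by (simp add: u_def single_2)
qed

lemma bd_exists:
  "\<exists>D. D \<in> hom A2 (chain_group N 1) \<and> (\<forall>c\<in>carrier C2. D (B2 #>\<^bsub>C2\<^esub> c) = boundary N c)"
proof -
  have b2: "boundary N \<in> hom C2 (chain_group N 1)"
    using boundary_hom[OF is_group, of 1] by (simp add: numeral_eq_Suc C2_def)
  interpret b: group_hom C2 "chain_group N 1" "boundary N"
    using comm_group_chain_group b2
    by (intro group_hom.intro group_hom_axioms.intro) (auto intro: comm_group.axioms C2.is_group)
  have "B2 \<subseteq> kernel C2 (chain_group N 1) (boundary N)"
    using boundary_boundary subgroup.mem_carrier[OF B2_subgroup]
    by (auto simp: kernel_def B2_def boundaries_def)
  then obtain g where "g \<in> hom (C2 Mod B2) (chain_group N 1)"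
    "\<And>c. c \<in> carrier C2 \<Longrightarrow> g (B2 #>\<^bsub>C2\<^esub> c) = boundary N c"
    using b.FactGroup_universal_kernel[OF B2_normal] by metis
  then show ?thesis unfolding A2_def by auto
qed

text \<open>The map C_2/B_2 -> C_1 induced by the boundary. Its kernel is H_2, so \<open>D\<close>
  is the test for a value of a cocycle to be a homology class.\<close>

definition D where
  "D = (SOME D. D \<in> hom A2 (chain_group N 1) \<and> (\<forall>c\<in>carrier C2. D (B2 #>\<^bsub>C2\<^esub> c) = boundary N c))"

lemma D_hom: "D \<in> hom A2 (chain_group N 1)"
  and D_coset: "c \<in> carrier C2 \<Longrightarrow> D (B2 #>\<^bsub>C2\<^esub> c) = boundary N c"
  using someI_ex[OF bd_exists] unfolding D_def[symmetric] by blast+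

lemma D_u:
  assumes "x \<in> carrier N" "y \<in> carrier N"
  shows "D (u x y) = (\<lambda>zs. single [y] zs - single [x \<otimes> y] zs + single [x] zs)"
  using assms by (simp add: u_def D_coset single_2 boundary_single_2)

definition H2 where "H2 = A2\<lparr>carrier := {a \<in> carrier A2. D a = (\<lambda>_. 0)}\<rparr>"

text \<open>An equality and not just an isomorphism: a coset of \<open>B2\<close> is the same set
  whether it is formed in the group of cycles or in \<open>C2\<close>, and both quotients multiply
  cosets as sets.\<close>

lemma group_homology_2: "group_homology N 2 = H2"
proof -
  have "rcosets\<^bsub>C2\<lparr>carrier := cycles N 2\<rparr>\<^esub> B2 = {a \<in> rcosets\<^bsub>C2\<^esub> B2. D a = (\<lambda>_. 0)}"
    using D_coset by (auto simp: RCOSETS_def r_coset_def cycles_def C2_def)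
  then show ?thesis
    by (simp add: group_homology_def H2_def A2_def FactGroup_def C2_def B2_def set_mult_def[abs_def])
qed

text \<open>The hypothesis says that the cocycles \<open>h\<close> u and \<open>h'\<close> u differ
  by the coboundary of \<phi>. With \<open>L\<close> the linear extension of \<phi> to C_1 this
  reads h = h' + L D on the generators of C_2/B_2, and D vanishes on H_2. All identities on H_2
  below are obtained in this way.\<close>

lemma lift_D_eq:
  assumes "comm_group B" "\<And>x. x \<in> carrier N \<Longrightarrow> \<phi> x \<in> carrier B" "h \<in> hom A2 B" "h' \<in> hom A2 B"
    and "\<And>x y. x \<in> carrier N \<Longrightarrow> y \<in> carrier N \<Longrightarrow>
           h (u x y) \<otimes>\<^bsub>B\<^esub> \<phi> (x \<otimes> y) = h' (u x y) \<otimes>\<^bsub>B\<^esub> (\<phi> x \<otimes>\<^bsub>B\<^esub> \<phi> y)"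
    and a: "a \<in> carrier H2"
  shows "h a = h' a"
proof -
  interpret B: comm_group B by fact
  interpret C1: comm_group "chain_group N 1" by (rule comm_group_chain_group)
  define L where "L = lift B (\<lambda>xs. \<phi> (xs ! 0))"
  have L: "L \<in> hom (chain_group N 1) B"
    unfolding L_def by (rule lift_hom) (auto intro: assms simp: length_Suc_conv)
  have Ls: "L (single [x]) = \<phi> x" if "x \<in> carrier N" for x
    using lift_single[OF assms(1), of "\<lambda>xs. \<phi> (xs ! 0)" "[x]"] assms(2)[OF that] by (simp add: L_def)
  interpret h: group_hom A2 B h
    by (intro group_hom.intro group_hom_axioms.intro) (rule assms A2.is_group B.is_group)+
  interpret h': group_hom A2 B h'
    by (intro group_hom.intro group_hom_axioms.intro) (rule assms A2.is_group B.is_group)+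
  interpret L: group_hom "chain_group N 1" B L
    by (intro group_hom.intro group_hom_axioms.intro) (rule L C1.is_group B.is_group)+
  have D_in: "D a \<in> chains N 1" if "a \<in> carrier A2" for a
    using D_hom that by (auto simp: hom_def)
  define h2 where "h2 a = h' a \<otimes>\<^bsub>B\<^esub> L (D a)" for a
  have h2: "h2 \<in> hom A2 B"
  proof (rule homI)
    fix a b assume "a \<in> carrier A2" "b \<in> carrier A2"
    then show "h2 (a \<otimes>\<^bsub>A2\<^esub> b) = h2 a \<otimes>\<^bsub>B\<^esub> h2 b"
      using D_in[of a] D_in[of b] hom_mult[OF D_hom, of a b] L.hom_mult[of "D a" "D b"] L.hom_closed
      by (simp add: h2_def B.m_ac)
  qed (use D_in L.hom_closed in \<open>auto simp: h2_def\<close>)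
  have "h a = h2 a"
  proof (rule A2_hom_eqI[OF assms(3) h2 B.is_group])
    fix x y assume xy: "x \<in> carrier N" "y \<in> carrier N"
    have "D (u x y) \<otimes>\<^bsub>chain_group N 1\<^esub> single [x \<otimes> y] = single [x] \<otimes>\<^bsub>chain_group N 1\<^esub> single [y]"
      using xy by (auto simp: D_u)
    then have "L (D (u x y)) \<otimes>\<^bsub>B\<^esub> \<phi> (x \<otimes> y) = \<phi> x \<otimes>\<^bsub>B\<^esub> \<phi> y"
      using xy D_in[OF u_in[OF xy]] L.hom_mult[of "D (u x y)" "single [x \<otimes> y]"] L.hom_mult[of "single [x]" "single [y]"]
      by (simp add: Ls single_chain)
    moreover have "L (D (u x y)) \<in> carrier B" "h' (u x y) \<in> carrier B" "h (u x y) \<in> carrier B"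
      using xy D_in L.hom_closed by (auto simp: u_in)
    ultimately have "h (u x y) \<otimes>\<^bsub>B\<^esub> \<phi> (x \<otimes> y) = h2 (u x y) \<otimes>\<^bsub>B\<^esub> \<phi> (x \<otimes> y)"
      using assms(5)[OF xy] xy assms(2) by (simp add: h2_def B.m_assoc)
    then show "h (u x y) = h2 (u x y)"
      using \<open>L (D (u x y)) \<in> carrier B\<close> xy assms(2) by (simp add: h2_def u_in)
  qed (use a in \<open>simp add: H2_def\<close>)
  also have "h2 a = h' a"
    using a L.hom_one by (simp add: h2_def H2_def)
  finally show ?thesis .
qed

end

section \<open>Splitting cocycles on the adjoint group up to the type\<close>

text \<open>Cocycles are not assumed normalised, which is why the identity carries the inverse of
  f(1, 1).\<close>

definition central_ext ::
  "('g, 'c) monoid_scheme \<Rightarrow> ('b, 'd) monoid_scheme \<Rightarrow> ('g \<Rightarrow> 'g \<Rightarrow> 'b) \<Rightarrow> ('g \<times> 'b) monoid" where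
  "central_ext N A f = \<lparr>carrier = carrier N \<times> carrier A,
     monoid.mult = (\<lambda>(x, a) (y, b). (x \<otimes>\<^bsub>N\<^esub> y, a \<otimes>\<^bsub>A\<^esub> b \<otimes>\<^bsub>A\<^esub> f x y)),
     one = (\<one>\<^bsub>N\<^esub>, inv\<^bsub>A\<^esub> (f \<one>\<^bsub>N\<^esub> \<one>\<^bsub>N\<^esub>))\<rparr>"

text \<open>The cocycle identity for the triple (1, 1, x); its counterpart
  \<open>cocycle_one_right\<close> uses (x, 1, 1). Together they do the work of
  normalisation.\<close>

lemma cocycle_one_left:
  assumes "group N" "comm_group A" "cocycle N A f" "x \<in> carrier N"
  shows "f \<one>\<^bsub>N\<^esub> x = f \<one>\<^bsub>N\<^esub> \<one>\<^bsub>N\<^esub>"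
proof -
  interpret N: group N by fact
  interpret A: comm_group A by fact
  have f: "f x y \<in> carrier A" if "x \<in> carrier N" "y \<in> carrier N" for x y
    using assms(3) that by (simp add: cocycle_def)
  have "f \<one>\<^bsub>N\<^esub> \<one>\<^bsub>N\<^esub> \<otimes>\<^bsub>A\<^esub> f (\<one>\<^bsub>N\<^esub> \<otimes>\<^bsub>N\<^esub> \<one>\<^bsub>N\<^esub>) x = f \<one>\<^bsub>N\<^esub> x \<otimes>\<^bsub>A\<^esub> f \<one>\<^bsub>N\<^esub> (\<one>\<^bsub>N\<^esub> \<otimes>\<^bsub>N\<^esub> x)"
    using assms(3,4) unfolding cocycle_def by (metis N.one_closed)
  then show ?thesis using assms(4) f by simp
qed

lemma cocycle_one_right:
  assumes "group N" "comm_group A" "cocycle N A f" "x \<in> carrier N"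
  shows "f x \<one>\<^bsub>N\<^esub> = f \<one>\<^bsub>N\<^esub> \<one>\<^bsub>N\<^esub>"
proof -
  interpret N: group N by fact
  interpret A: comm_group A by fact
  have f: "f x y \<in> carrier A" if "x \<in> carrier N" "y \<in> carrier N" for x y
    using assms(3) that by (simp add: cocycle_def)
  have "f x \<one>\<^bsub>N\<^esub> \<otimes>\<^bsub>A\<^esub> f (x \<otimes>\<^bsub>N\<^esub> \<one>\<^bsub>N\<^esub>) \<one>\<^bsub>N\<^esub> = f \<one>\<^bsub>N\<^esub> \<one>\<^bsub>N\<^esub> \<otimes>\<^bsub>A\<^esub> f x (\<one>\<^bsub>N\<^esub> \<otimes>\<^bsub>N\<^esub> \<one>\<^bsub>N\<^esub>)"
    using assms(3,4) unfolding cocycle_def by (metis N.one_closed)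
  then show ?thesis using assms(4) f by simp
qed

lemma group_central_ext:
  assumes "group N" "comm_group A" "cocycle N A f"
  shows "group (central_ext N A f)"
proof -
  interpret N: group N by fact
  interpret A: comm_group A by fact
  have f [simp]: "f x y \<in> carrier A" if "x \<in> carrier N" "y \<in> carrier N" for x y
    using assms(3) that by (simp add: cocycle_def)
  have coc: "f x y \<otimes>\<^bsub>A\<^esub> f (x \<otimes>\<^bsub>N\<^esub> y) z = f y z \<otimes>\<^bsub>A\<^esub> f x (y \<otimes>\<^bsub>N\<^esub> z)"
    if "x \<in> carrier N" "y \<in> carrier N" "z \<in> carrier N" for x y z
    using assms(3) that by (simp add: cocycle_def)
  show ?thesis
  proof (rule groupI)
    fix p q r assume pqr: "p \<in> carrier (central_ext N A f)" "q \<in> carrier (central_ext N A f)"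
      "r \<in> carrier (central_ext N A f)"
    then obtain x a y b z c where e: "p = (x, a)" "q = (y, b)" "r = (z, c)"
      and i: "x \<in> carrier N" "y \<in> carrier N" "z \<in> carrier N" "a \<in> carrier A" "b \<in> carrier A" "c \<in> carrier A"
      by (auto simp: central_ext_def)
    have "a \<otimes>\<^bsub>A\<^esub> b \<otimes>\<^bsub>A\<^esub> f x y \<otimes>\<^bsub>A\<^esub> c \<otimes>\<^bsub>A\<^esub> f (x \<otimes>\<^bsub>N\<^esub> y) z
      = a \<otimes>\<^bsub>A\<^esub> b \<otimes>\<^bsub>A\<^esub> c \<otimes>\<^bsub>A\<^esub> (f x y \<otimes>\<^bsub>A\<^esub> f (x \<otimes>\<^bsub>N\<^esub> y) z)"
      using i by (simp add: A.m_ac)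
    also have "\<dots> = a \<otimes>\<^bsub>A\<^esub> (b \<otimes>\<^bsub>A\<^esub> c \<otimes>\<^bsub>A\<^esub> f y z) \<otimes>\<^bsub>A\<^esub> f x (y \<otimes>\<^bsub>N\<^esub> z)"
      using i by (simp add: coc A.m_ac)
    finally show "p \<otimes>\<^bsub>central_ext N A f\<^esub> q \<otimes>\<^bsub>central_ext N A f\<^esub> r
        = p \<otimes>\<^bsub>central_ext N A f\<^esub> (q \<otimes>\<^bsub>central_ext N A f\<^esub> r)"
      using i by (simp add: central_ext_def e N.m_assoc)
  next
    fix p assume "p \<in> carrier (central_ext N A f)"
    then obtain x a where e: "p = (x, a)" and i: "x \<in> carrier N" "a \<in> carrier A"
      by (auto simp: central_ext_def)
    show "\<one>\<^bsub>central_ext N A f\<^esub> \<otimes>\<^bsub>central_ext N A f\<^esub> p = p"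
      using i by (simp add: central_ext_def e cocycle_one_left[OF assms i(1)] A.m_comm[of _ a] A.m_assoc)
    \<comment> \<open>The second component b is solved from b + a + f(x^{-1}, x) = -f(1, 1).\<close>
    define q where "q = (inv\<^bsub>N\<^esub> x, inv\<^bsub>A\<^esub> (f \<one>\<^bsub>N\<^esub> \<one>\<^bsub>N\<^esub>) \<otimes>\<^bsub>A\<^esub> inv\<^bsub>A\<^esub> (f (inv\<^bsub>N\<^esub> x) x) \<otimes>\<^bsub>A\<^esub> inv\<^bsub>A\<^esub> a)"
    have "q \<otimes>\<^bsub>central_ext N A f\<^esub> p = \<one>\<^bsub>central_ext N A f\<^esub>"
      using i by (simp add: central_ext_def e q_def A.m_assoc)
    moreover have "q \<in> carrier (central_ext N A f)"
      using i by (simp add: central_ext_def q_def)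
    ultimately show "\<exists>q\<in>carrier (central_ext N A f). q \<otimes>\<^bsub>central_ext N A f\<^esub> p = \<one>\<^bsub>central_ext N A f\<^esub>"
      by blast
  qed (auto simp: central_ext_def)
qed

text \<open>Up to a constant, the \<open>A\<close>-coordinate of a power of the standard lift: in
  \<open>central_ext\<close>, (g, 1)^n = (g^n, s) where s is \<open>power_defect\<close> divided by
  f(1, 1).\<close>

primrec power_defect ::
  "('g, 'c) monoid_scheme \<Rightarrow> ('b, 'd) monoid_scheme \<Rightarrow> ('g \<Rightarrow> 'g \<Rightarrow> 'b) \<Rightarrow> 'g \<Rightarrow> nat \<Rightarrow> 'b" where
  "power_defect N A f g 0 = \<one>\<^bsub>A\<^esub>"
| "power_defect N A f g (Suc n) = power_defect N A f g n \<otimes>\<^bsub>A\<^esub> f (g [^]\<^bsub>N\<^esub> n) g"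

text \<open>In the central extension of \<open>N\<close> by \<open>A\<close> with cocycle \<open>f\<close>, let \<open>w\<close>, \<open>w'\<close> and \<open>v\<close> be the
  standard lifts of \<open>g\<close>, \<open>g'\<close> and \<open>h\<close>. The lemma compares \<open>v w'^n\<close> with \<open>w^n v\<close>.\<close>

lemma power_defect_conj:
  assumes "group N" "comm_group A" "cocycle N A f"
    and g: "g \<in> carrier N" "g' \<in> carrier N" "h \<in> carrier N" and conj: "h \<otimes>\<^bsub>N\<^esub> g' = g \<otimes>\<^bsub>N\<^esub> h"
  shows "f h (g' [^]\<^bsub>N\<^esub> n) \<otimes>\<^bsub>A\<^esub> power_defect N A f g' n \<otimes>\<^bsub>A\<^esub> f g h [^]\<^bsub>A\<^esub> n
       = f (g [^]\<^bsub>N\<^esub> n) h \<otimes>\<^bsub>A\<^esub> power_defect N A f g n \<otimes>\<^bsub>A\<^esub> f h g' [^]\<^bsub>A\<^esub> (n::nat)"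
proof -
  interpret N: group N by fact
  interpret A: comm_group A by fact
  have f [simp]: "f x y \<in> carrier A" if "x \<in> carrier N" "y \<in> carrier N" for x y
    using assms(3) that by (simp add: cocycle_def)
  have coc: "f x y \<otimes>\<^bsub>A\<^esub> f (x \<otimes>\<^bsub>N\<^esub> y) z = f y z \<otimes>\<^bsub>A\<^esub> f x (y \<otimes>\<^bsub>N\<^esub> z)"
    if "x \<in> carrier N" "y \<in> carrier N" "z \<in> carrier N" for x y z
    using assms(3) that by (simp add: cocycle_def)
  have pd [simp]: "power_defect N A f x n \<in> carrier A" if "x \<in> carrier N" for x n
    using that by (induction n) auto
  have conj_n: "h \<otimes>\<^bsub>N\<^esub> g' [^]\<^bsub>N\<^esub> n = g [^]\<^bsub>N\<^esub> n \<otimes>\<^bsub>N\<^esub> h" for n :: nat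
  proof (induction n)
    case (Suc n)
    have "h \<otimes>\<^bsub>N\<^esub> g' [^]\<^bsub>N\<^esub> Suc n = (h \<otimes>\<^bsub>N\<^esub> g' [^]\<^bsub>N\<^esub> n) \<otimes>\<^bsub>N\<^esub> g'"
      using g by (simp add: N.m_assoc)
    also have "\<dots> = g [^]\<^bsub>N\<^esub> n \<otimes>\<^bsub>N\<^esub> (h \<otimes>\<^bsub>N\<^esub> g')"
      using g by (simp add: Suc N.m_assoc)
    finally show ?case
      using g by (simp add: conj N.m_assoc)
  qed (use g in simp)
  show ?thesis
  proof (induction n)
    case 0
    then show ?case
      using g by (simp add: cocycle_one_left[OF assms(1-3) g(3)] cocycle_one_right[OF assms(1-3) g(3)])
  next
    case (Suc n)
    let ?w = "f g h" and ?v = "f h g'" and ?p = "f (g' [^]\<^bsub>N\<^esub> n) g'" and ?r = "f (g [^]\<^bsub>N\<^esub> n) g"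
    let ?q = "f (g [^]\<^bsub>N\<^esub> n \<otimes>\<^bsub>N\<^esub> h) g'" and ?m = "f (g [^]\<^bsub>N\<^esub> n) (g \<otimes>\<^bsub>N\<^esub> h)"
    let ?S' = "power_defect N A f g' n" and ?S = "power_defect N A f g n"
    let ?F = "f h (g' [^]\<^bsub>N\<^esub> n)" and ?G = "f (g [^]\<^bsub>N\<^esub> n) h"
    let ?F1 = "f h (g' [^]\<^bsub>N\<^esub> Suc n)" and ?G1 = "f (g [^]\<^bsub>N\<^esub> Suc n) h"
    \<comment> \<open>The induction step rebrackets v(w'^n w') = (v w'^n)w' = (w^n v)w' = w^n(v w')
      and w^n(w v) = (w^n w)v, up to central factors. The outer regroupings are \<open>1\<close> and
      \<open>2\<close>, the middle one is \<open>3\<close>.\<close>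
    have 1: "?p \<otimes>\<^bsub>A\<^esub> ?F1 = ?F \<otimes>\<^bsub>A\<^esub> ?q"
      using coc[of h "g' [^]\<^bsub>N\<^esub> n" g'] g by (simp add: conj_n)
    have 2: "?r \<otimes>\<^bsub>A\<^esub> ?G1 = ?w \<otimes>\<^bsub>A\<^esub> ?m"
      using coc[of "g [^]\<^bsub>N\<^esub> n" g h] g by simp
    have 3: "?G \<otimes>\<^bsub>A\<^esub> ?q = ?v \<otimes>\<^bsub>A\<^esub> ?m"
      using coc[of "g [^]\<^bsub>N\<^esub> n" h g'] g by (simp add: conj)
    have "?F1 \<otimes>\<^bsub>A\<^esub> (?S' \<otimes>\<^bsub>A\<^esub> ?p) \<otimes>\<^bsub>A\<^esub> (?w [^]\<^bsub>A\<^esub> n \<otimes>\<^bsub>A\<^esub> ?w)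
      = (?p \<otimes>\<^bsub>A\<^esub> ?F1) \<otimes>\<^bsub>A\<^esub> (?S' \<otimes>\<^bsub>A\<^esub> ?w [^]\<^bsub>A\<^esub> n \<otimes>\<^bsub>A\<^esub> ?w)"
      using g by (simp add: A.m_ac del: nat_pow_Suc)
    also have "\<dots> = (?F \<otimes>\<^bsub>A\<^esub> ?S' \<otimes>\<^bsub>A\<^esub> ?w [^]\<^bsub>A\<^esub> n) \<otimes>\<^bsub>A\<^esub> (?q \<otimes>\<^bsub>A\<^esub> ?w)"
      unfolding 1 using g by (simp add: A.m_ac del: nat_pow_Suc)
    also have "\<dots> = (?G \<otimes>\<^bsub>A\<^esub> ?q) \<otimes>\<^bsub>A\<^esub> (?S \<otimes>\<^bsub>A\<^esub> ?v [^]\<^bsub>A\<^esub> n \<otimes>\<^bsub>A\<^esub> ?w)"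
      unfolding Suc.IH using g by (simp add: A.m_ac del: nat_pow_Suc)
    also have "\<dots> = (?w \<otimes>\<^bsub>A\<^esub> ?m) \<otimes>\<^bsub>A\<^esub> (?S \<otimes>\<^bsub>A\<^esub> ?v [^]\<^bsub>A\<^esub> n \<otimes>\<^bsub>A\<^esub> ?v)"
      unfolding 3 using g by (simp add: A.m_ac del: nat_pow_Suc)
    also have "\<dots> = ?G1 \<otimes>\<^bsub>A\<^esub> (?S \<otimes>\<^bsub>A\<^esub> ?r) \<otimes>\<^bsub>A\<^esub> (?v [^]\<^bsub>A\<^esub> n \<otimes>\<^bsub>A\<^esub> ?v)"
      unfolding 2[symmetric] using g by (simp add: A.m_ac del: nat_pow_Suc)
    finally show ?case by simp
  qed
qed

section \<open>Powers of the generators and the splitting\<close>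

locale connected_quandle_on = quandle_on +
  assumes nonempty: "Q \<noteq> {}" and connected: "connected_quandle Q qop"
    and finite_type: "has_finite_type Q qop"
begin

abbreviation t where "t \<equiv> quandle_type Q qop"

lemma type_id: "x \<in> Q \<Longrightarrow> y \<in> Q \<Longrightarrow> ((\<lambda>z. qop z y) ^^ t) x = x"
proof -
  have "t > 0 \<and> (\<forall>x\<in>Q. \<forall>y\<in>Q. ((\<lambda>z. qop z y) ^^ t) x = x)"
    using finite_type unfolding has_finite_type_def quandle_type_def by (rule LeastI_ex)
  then show "x \<in> Q \<Longrightarrow> y \<in> Q \<Longrightarrow> ((\<lambda>z. qop z y) ^^ t) x = x" by blast
qed

text \<open>Equivariance of x -> e_x, the defining relation iterated along a word. It makes all
  generators conjugate when X is connected (\<open>gen_conj\<close>) and makes the kernel of the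
  action central (\<open>K_central\<close>).\<close>

lemma gen_word_act:
  assumes "x \<in> Q" "w \<in> words Q"
  shows "gen (word_act Q qop x w) = inv\<^bsub>G\<^esub> (wcl w) \<otimes>\<^bsub>G\<^esub> gen x \<otimes>\<^bsub>G\<^esub> wcl w"
  using assms
proof (induction w arbitrary: x)
  case Nil
  then show ?case by (simp flip: one_As)
next
  case (Cons l w)
  obtain y b where l: "l = (y, b)" by force
  have y: "y \<in> Q" and w: "w \<in> words Q" using Cons.prems l by auto
  have c: "wcl w \<in> carrier G" using w by (rule wcl_in)
  show ?case
  proof (cases b)
    case True
    then show ?thesis
      using Cons.IH[of "qop x y"] Cons.prems y w c
      by (simp add: l wcl_Cons qop_closed gen_qop G.inv_mult_group G.m_assoc)
  next
    case False
    define z where "z = the_inv_into Q (\<lambda>z. qop z y) x"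
    have z: "z \<in> Q" using Cons.prems y word_act_in[of x "[(y, False)]"] by (simp add: z_def)
    have "gen x = inv\<^bsub>G\<^esub> (gen y) \<otimes>\<^bsub>G\<^esub> gen z \<otimes>\<^bsub>G\<^esub> gen y"
      using gen_qop[OF z y] qop_inv(1)[of x y] Cons.prems y by (simp add: z_def)
    then have "gen y \<otimes>\<^bsub>G\<^esub> gen x = gen z \<otimes>\<^bsub>G\<^esub> gen y"
      using y z by (simp add: G.m_assoc) (simp add: G.m_assoc[symmetric])
    then have "gen z = gen y \<otimes>\<^bsub>G\<^esub> gen x \<otimes>\<^bsub>G\<^esub> inv\<^bsub>G\<^esub> (gen y)"
      using y z Cons.prems by (simp add: G.m_assoc)
    then show ?thesis
      using Cons.IH[OF z w] Cons.prems y w c False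
      by (simp add: l wcl_Cons z_def[symmetric] G.inv_mult_group G.m_assoc)
  qed
qed

lemma gen_conj:
  assumes "x \<in> Q" "y \<in> Q"
  obtains g where "g \<in> carrier G" "gen y = inv\<^bsub>G\<^esub> g \<otimes>\<^bsub>G\<^esub> gen x \<otimes>\<^bsub>G\<^esub> g"
proof -
  obtain w where "w \<in> words Q" "word_act Q qop x w = y"
    using connected assms unfolding connected_quandle_def by blast
  then show ?thesis
    using that[of "wcl w"] gen_word_act[OF assms(1), of w] wcl_in by simp
qed

lemma central_if_commutes_gen:
  assumes "z \<in> carrier G" "\<And>x. x \<in> Q \<Longrightarrow> gen x \<otimes>\<^bsub>G\<^esub> z = z \<otimes>\<^bsub>G\<^esub> gen x" "g \<in> carrier G"
  shows "g \<otimes>\<^bsub>G\<^esub> z = z \<otimes>\<^bsub>G\<^esub> g"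
  using assms(3)
proof (induction rule: As_induct)
  case (gen x g)
  have "gen x \<otimes>\<^bsub>G\<^esub> g \<otimes>\<^bsub>G\<^esub> z = gen x \<otimes>\<^bsub>G\<^esub> z \<otimes>\<^bsub>G\<^esub> g"
    using gen assms(1) by (simp add: G.m_assoc)
  then show ?case using gen assms(1,2) by (simp add: G.m_assoc)
next
  case (inv_gen x g)
  have "inv\<^bsub>G\<^esub> (gen x) \<otimes>\<^bsub>G\<^esub> z = inv\<^bsub>G\<^esub> (gen x) \<otimes>\<^bsub>G\<^esub> (z \<otimes>\<^bsub>G\<^esub> gen x) \<otimes>\<^bsub>G\<^esub> inv\<^bsub>G\<^esub> (gen x)"
    using inv_gen assms(1) by (simp add: G.m_assoc)
  also have "\<dots> = z \<otimes>\<^bsub>G\<^esub> inv\<^bsub>G\<^esub> (gen x)"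
    using inv_gen assms(1) by (simp add: assms(2)[symmetric] G.m_assoc[symmetric])
  finally have c: "inv\<^bsub>G\<^esub> (gen x) \<otimes>\<^bsub>G\<^esub> z = z \<otimes>\<^bsub>G\<^esub> inv\<^bsub>G\<^esub> (gen x)" .
  have "inv\<^bsub>G\<^esub> (gen x) \<otimes>\<^bsub>G\<^esub> g \<otimes>\<^bsub>G\<^esub> z = inv\<^bsub>G\<^esub> (gen x) \<otimes>\<^bsub>G\<^esub> z \<otimes>\<^bsub>G\<^esub> g"
    using inv_gen assms(1) by (simp add: G.m_assoc)
  then show ?case using inv_gen assms(1) c by (simp add: G.m_assoc)
qed (simp add: assms(1))

lemma conj_pow:
  assumes "g \<in> carrier G" "a \<in> carrier G"
  shows "(inv\<^bsub>G\<^esub> g \<otimes>\<^bsub>G\<^esub> a \<otimes>\<^bsub>G\<^esub> g) [^]\<^bsub>G\<^esub> (n::nat) = inv\<^bsub>G\<^esub> g \<otimes>\<^bsub>G\<^esub> a [^]\<^bsub>G\<^esub> n \<otimes>\<^bsub>G\<^esub> g"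
  by (induction n) (use assms in \<open>simp_all add: G.m_assoc G.mult_inv_cancel\<close>)

text \<open>Moving e_x past n letters e_y turns it into the generator of the n-fold product of x by
  y, which is x again for n = \<open>t\<close>.\<close>

lemma gen_pow_type_commutes:
  assumes "x \<in> Q" "y \<in> Q"
  shows "gen x \<otimes>\<^bsub>G\<^esub> gen y [^]\<^bsub>G\<^esub> t = gen y [^]\<^bsub>G\<^esub> t \<otimes>\<^bsub>G\<^esub> gen x"
proof -
  have "((\<lambda>z. qop z y) ^^ n) x \<in> Q \<and>
      gen x \<otimes>\<^bsub>G\<^esub> gen y [^]\<^bsub>G\<^esub> n = gen y [^]\<^bsub>G\<^esub> n \<otimes>\<^bsub>G\<^esub> gen (((\<lambda>z. qop z y) ^^ n) x)" for n
  proof (induction n)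
    case (Suc n)
    let ?x = "((\<lambda>z. qop z y) ^^ n) x"
    have x: "?x \<in> Q" using Suc by blast
    have "gen x \<otimes>\<^bsub>G\<^esub> gen y [^]\<^bsub>G\<^esub> Suc n = (gen x \<otimes>\<^bsub>G\<^esub> gen y [^]\<^bsub>G\<^esub> n) \<otimes>\<^bsub>G\<^esub> gen y"
      using assms by (simp add: G.m_assoc)
    also have "\<dots> = gen y [^]\<^bsub>G\<^esub> n \<otimes>\<^bsub>G\<^esub> (gen ?x \<otimes>\<^bsub>G\<^esub> gen y)"
      using assms Suc x by (simp add: G.m_assoc)
    also have "gen ?x \<otimes>\<^bsub>G\<^esub> gen y = gen y \<otimes>\<^bsub>G\<^esub> gen (qop ?x y)"
      using assms x by (simp add: gen_qop G.m_assoc[symmetric])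
    finally show ?case
      using assms x by (simp add: G.m_assoc qop_closed)
  qed (use assms in simp)
  then show ?thesis using type_id[OF assms] by metis
qed

text \<open>The generators are conjugate, hence so are their t-th powers; but these are central, and
  a central element is its only conjugate.\<close>

lemma gen_pow_type_eq:
  assumes "x \<in> Q" "y \<in> Q"
  shows "gen x [^]\<^bsub>G\<^esub> t = gen y [^]\<^bsub>G\<^esub> t"
proof -
  obtain g where g: "g \<in> carrier G" "gen y = inv\<^bsub>G\<^esub> g \<otimes>\<^bsub>G\<^esub> gen x \<otimes>\<^bsub>G\<^esub> g"
    using assms by (rule gen_conj)
  have "g \<otimes>\<^bsub>G\<^esub> gen x [^]\<^bsub>G\<^esub> t = gen x [^]\<^bsub>G\<^esub> t \<otimes>\<^bsub>G\<^esub> g"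
    by (rule central_if_commutes_gen[OF _ _ g(1)]) (simp_all add: assms gen_pow_type_commutes[OF _ assms(1)])
  then have "inv\<^bsub>G\<^esub> g \<otimes>\<^bsub>G\<^esub> gen x [^]\<^bsub>G\<^esub> t \<otimes>\<^bsub>G\<^esub> g = inv\<^bsub>G\<^esub> g \<otimes>\<^bsub>G\<^esub> (g \<otimes>\<^bsub>G\<^esub> gen x [^]\<^bsub>G\<^esub> t)"
    using assms g(1) by (simp add: G.m_assoc)
  then show ?thesis
    using g(1) assms unfolding g(2) by (simp add: conj_pow G.inv_mult_cancel)
qed

text \<open>A section of the pushed-out extension is constructed on generators; its
  \<open>A\<close>-coordinate is, up to sign, \<sigma>. The values of \<sigma> on generators are
  recorded because they later decide where \<sigma> sits relative to H_2.\<close>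

theorem type_splitting:
  assumes "comm_group A" "cocycle G A f"
  obtains \<sigma> where "\<sigma> \<in> carrier G \<rightarrow> carrier A"
    "\<And>g h. g \<in> carrier G \<Longrightarrow> h \<in> carrier G \<Longrightarrow>
       f g h [^]\<^bsub>A\<^esub> t \<otimes>\<^bsub>A\<^esub> \<sigma> (g \<otimes>\<^bsub>G\<^esub> h) = \<sigma> g \<otimes>\<^bsub>A\<^esub> \<sigma> h"
    "\<And>x. x \<in> Q \<Longrightarrow> \<sigma> (gen x) = power_defect G A f (gen x) t"
proof -
  interpret A: comm_group A by fact
  have f [simp]: "f x y \<in> carrier A" if "x \<in> carrier G" "y \<in> carrier G" for x y
    using assms(2) that by (simp add: cocycle_def)
  have pd [simp]: "power_defect G A f x n \<in> carrier A" if "x \<in> carrier G" for x n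
    using that by (induction n) auto
  define ft where "ft g h = f g h [^]\<^bsub>A\<^esub> t" for g h
  have ft_coc: "cocycle G A ft"
    unfolding cocycle_def
  proof (intro conjI ballI)
    fix x y z assume "x \<in> carrier G" "y \<in> carrier G" "z \<in> carrier G"
    moreover from this have "f x y \<otimes>\<^bsub>A\<^esub> f (x \<otimes>\<^bsub>G\<^esub> y) z = f y z \<otimes>\<^bsub>A\<^esub> f x (y \<otimes>\<^bsub>G\<^esub> z)"
      using assms(2) by (simp add: cocycle_def)
    ultimately show "ft x y \<otimes>\<^bsub>A\<^esub> ft (x \<otimes>\<^bsub>G\<^esub> y) z = ft y z \<otimes>\<^bsub>A\<^esub> ft x (y \<otimes>\<^bsub>G\<^esub> z)"
      by (simp add: ft_def A.nat_pow_distrib[symmetric])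
  qed (simp add: ft_def)
  define E where "E = central_ext G A ft"
  interpret E: group E unfolding E_def by (rule group_central_ext[OF group_As assms(1) ft_coc])
  define S where "S x = power_defect G A f (gen x) t" for x
  \<comment> \<open>The powers \<open>S\<close> are computed with \<open>f\<close>, but the lifts
    corrected by them live in the extension by \<open>ft\<close>: taking t-th powers multiplies the
    defect of a relation by t, and this is the defect measured by \<open>ft\<close>.\<close>
  define \<phi> where "\<phi> x = (gen x, inv\<^bsub>A\<^esub> (S x))" for x
  have S_in [simp]: "S x \<in> carrier A" if "x \<in> Q" for x using that by (simp add: S_def)
  have S_conj: "S (qop x y) \<otimes>\<^bsub>A\<^esub> ft (gen x) (gen y) = S x \<otimes>\<^bsub>A\<^esub> ft (gen y) (gen (qop x y))"
    if xy: "x \<in> Q" "y \<in> Q" for x y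
  proof -
    have q: "qop x y \<in> Q" using xy by (rule qop_closed)
    \<comment> \<open>The instance g = g' = h = e_y of \<open>power_defect_conj\<close> says that
      e_y and its power commute also after lifting. All generators have the same t-th power, so in
      the instance for the pair (x, y) the two terms containing that power cancel, leaving only
      \<open>S\<close> and \<open>ft\<close>.\<close>
    have "f (gen y) (gen y [^]\<^bsub>G\<^esub> t) = f (gen y [^]\<^bsub>G\<^esub> t) (gen y)"
      using power_defect_conj[OF group_As assms, of "gen y" "gen y" "gen y" t] xy by simp
    then have "f (gen y) (gen (qop x y) [^]\<^bsub>G\<^esub> t) = f (gen x [^]\<^bsub>G\<^esub> t) (gen y)"
      using gen_pow_type_eq[of y] xy q by metis
    moreover have "gen y \<otimes>\<^bsub>G\<^esub> gen (qop x y) = gen x \<otimes>\<^bsub>G\<^esub> gen y"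
      using xy by (simp add: gen_qop G.m_assoc[symmetric])
    ultimately show ?thesis
      using power_defect_conj[OF group_As assms, of "gen x" "gen (qop x y)" "gen y" t] xy q
      by (simp add: A.m_assoc S_def ft_def)
  qed
  have \<phi>_in: "\<phi> x \<in> carrier E" if "x \<in> Q" for x
    using that by (simp add: \<phi>_def E_def central_ext_def)
  have "\<phi> (qop x y) = inv\<^bsub>E\<^esub> (\<phi> y) \<otimes>\<^bsub>E\<^esub> \<phi> x \<otimes>\<^bsub>E\<^esub> \<phi> y" if xy: "x \<in> Q" "y \<in> Q" for x y
  proof -
    have q: "qop x y \<in> Q" using xy by (rule qop_closed)
    let ?w = "ft (gen x) (gen y)" and ?v = "ft (gen y) (gen (qop x y))"
    have wv: "?w \<in> carrier A" "?v \<in> carrier A" using xy q by (simp_all add: ft_def)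
    have "inv\<^bsub>A\<^esub> (S (qop x y)) \<otimes>\<^bsub>A\<^esub> ?v = inv\<^bsub>A\<^esub> (S x) \<otimes>\<^bsub>A\<^esub> inv\<^bsub>A\<^esub> (S (qop x y)) \<otimes>\<^bsub>A\<^esub> (S x \<otimes>\<^bsub>A\<^esub> ?v)"
      using xy q wv by (simp add: A.m_ac A.mult_inv_cancel)
    also have "\<dots> = inv\<^bsub>A\<^esub> (S x) \<otimes>\<^bsub>A\<^esub> inv\<^bsub>A\<^esub> (S (qop x y)) \<otimes>\<^bsub>A\<^esub> (S (qop x y) \<otimes>\<^bsub>A\<^esub> ?w)"
      using S_conj[OF xy] by simp
    also have "\<dots> = inv\<^bsub>A\<^esub> (S x) \<otimes>\<^bsub>A\<^esub> ?w"
      using xy q wv by (simp add: A.m_assoc) (simp add: A.m_assoc[symmetric])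
    finally have s: "inv\<^bsub>A\<^esub> (S (qop x y)) \<otimes>\<^bsub>A\<^esub> ?v = inv\<^bsub>A\<^esub> (S x) \<otimes>\<^bsub>A\<^esub> ?w" .
    have "\<phi> y \<otimes>\<^bsub>E\<^esub> \<phi> (qop x y) = \<phi> x \<otimes>\<^bsub>E\<^esub> \<phi> y"
      using xy q wv s by (simp add: \<phi>_def E_def central_ext_def gen_qop G.m_assoc[symmetric])
         (simp add: A.m_ac gen_qop)
    then have "inv\<^bsub>E\<^esub> (\<phi> y) \<otimes>\<^bsub>E\<^esub> (\<phi> y \<otimes>\<^bsub>E\<^esub> \<phi> (qop x y)) = inv\<^bsub>E\<^esub> (\<phi> y) \<otimes>\<^bsub>E\<^esub> (\<phi> x \<otimes>\<^bsub>E\<^esub> \<phi> y)"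
      by simp
    then show ?thesis using xy q \<phi>_in by (simp add: E.m_assoc[symmetric])
  qed
  then obtain \<tau> where \<tau>: "\<tau> \<in> hom G E" and \<tau>_gen: "\<And>x. x \<in> Q \<Longrightarrow> \<tau> (gen x) = \<phi> x"
    using As_universal[OF E.is_group, of \<phi>] \<phi>_in by blast
  \<comment> \<open>\<tau> is a section of the extension, as its first component fixes the
    generators. Its second component then has \<open>ft\<close> as coboundary, up to sign.\<close>
  have fst_hom: "fst \<circ> \<tau> \<in> hom G G"
    using \<tau> by (auto simp: hom_def E_def central_ext_def Pi_iff mem_Times_iff split: prod.splits)
  have id_hom: "(\<lambda>g. g) \<in> hom G G" by (simp add: hom_def)
  have fst: "fst (\<tau> g) = g" if "g \<in> carrier G" for g
    using hom_eq_on_gen[OF fst_hom id_hom group_As _ that] by (simp add: \<tau>_gen \<phi>_def)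
  have snd_in: "snd (\<tau> g) \<in> carrier A" if "g \<in> carrier G" for g
    using \<tau> that by (auto simp: hom_def E_def central_ext_def Pi_iff mem_Times_iff)
  have snd: "snd (\<tau> (g \<otimes>\<^bsub>G\<^esub> h)) = snd (\<tau> g) \<otimes>\<^bsub>A\<^esub> snd (\<tau> h) \<otimes>\<^bsub>A\<^esub> ft g h"
    if "g \<in> carrier G" "h \<in> carrier G" for g h
    using hom_mult[OF \<tau> that] fst[OF that(1)] fst[OF that(2)]
    by (simp add: E_def central_ext_def split: prod.splits)
  show ?thesis
  proof (rule that[of "\<lambda>g. inv\<^bsub>A\<^esub> (snd (\<tau> g))"])
    fix g h assume gh: "g \<in> carrier G" "h \<in> carrier G"
    have "ft g h \<in> carrier A" using gh by (simp add: ft_def)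
    then show "f g h [^]\<^bsub>A\<^esub> t \<otimes>\<^bsub>A\<^esub> inv\<^bsub>A\<^esub> (snd (\<tau> (g \<otimes>\<^bsub>G\<^esub> h))) = inv\<^bsub>A\<^esub> (snd (\<tau> g)) \<otimes>\<^bsub>A\<^esub> inv\<^bsub>A\<^esub> (snd (\<tau> h))"
      unfolding snd[OF gh] ft_def[symmetric] using gh snd_in
      by (simp add: A.inv_mult A.m_comm[of "ft g h"] A.m_assoc)
  qed (auto simp: snd_in \<tau>_gen \<phi>_def S_def)
qed

end

section \<open>A criterion for isomorphisms away from N\<close>

lemma equiv_loc_rel:
  assumes "comm_group A" "Factorial_Ring.prime l"
  shows "equiv (carrier A \<times> {s. \<not> l dvd s}) (loc_rel A l)"
proof (rule equivI)
  interpret A: comm_group A by fact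
  have not_dvd: "\<not> l dvd m * n" if "\<not> l dvd m" "\<not> l dvd n" for m n
    using that assms(2) by (simp add: prime_dvd_mult_iff)
  show "refl_on (carrier A \<times> {s. \<not> l dvd s}) (loc_rel A l)"
    using assms(2) by (auto simp: refl_on_def loc_rel_def intro!: exI[of _ 1])
  show "sym (loc_rel A l)"
  proof (rule symI)
    fix p q assume "(p, q) \<in> loc_rel A l"
    then show "(q, p) \<in> loc_rel A l"
      unfolding loc_rel_def by (auto intro: sym)
  qed
  show "loc_rel A l \<subseteq> (carrier A \<times> {s. \<not> l dvd s}) \<times> (carrier A \<times> {s. \<not> l dvd s})"
    by (auto simp: loc_rel_def)
  show "trans (loc_rel A l)"
  proof (rule transI)
    fix p q r assume pq: "(p, q) \<in> loc_rel A l" and qr: "(q, r) \<in> loc_rel A l"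
    obtain a s b u c w where pqr: "p = (a, s)" "q = (b, u)" "r = (c, w)"
      by (metis surj_pair)
    from pq obtain v where v: "\<not> l dvd v" "a [^]\<^bsub>A\<^esub> (u * v) = b [^]\<^bsub>A\<^esub> (s * v)"
      by (auto simp: loc_rel_def pqr)
    from qr obtain v' where v': "\<not> l dvd v'" "b [^]\<^bsub>A\<^esub> (w * v') = c [^]\<^bsub>A\<^esub> (u * v')"
      by (auto simp: loc_rel_def pqr)
    have in_A: "a \<in> carrier A" "b \<in> carrier A" "c \<in> carrier A"
      and dvd: "\<not> l dvd s" "\<not> l dvd u" "\<not> l dvd w"
      using pq qr by (auto simp: loc_rel_def pqr)
    \<comment> \<open>The multiplier u v v' lets both relations be applied: v' carries a to b in the
      first and u v carries on to c in the second after regrouping. It stays prime to l because l is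
      prime.\<close>
    have "a [^]\<^bsub>A\<^esub> (w * (u * v * v')) = (a [^]\<^bsub>A\<^esub> (u * v)) [^]\<^bsub>A\<^esub> (w * v')"
      using in_A by (simp add: A.nat_pow_pow ac_simps)
    also have "\<dots> = (b [^]\<^bsub>A\<^esub> (w * v')) [^]\<^bsub>A\<^esub> (s * v)"
      unfolding v(2) using in_A by (simp add: A.nat_pow_pow ac_simps)
    also have "\<dots> = c [^]\<^bsub>A\<^esub> (s * (u * v * v'))"
      unfolding v'(2) using in_A by (simp add: A.nat_pow_pow ac_simps)
    finally show "(p, r) \<in> loc_rel A l"
      using in_A dvd v(1) v'(1) not_dvd
      by (auto simp: loc_rel_def pqr intro!: exI[of _ "u * v * v'"])
  qed
qed

text \<open>N is invertible after localising at l, so a kernel killed by N and a cokernel killed by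
  N^2 both disappear. The square is the exponent that the application provides.\<close>

lemma inv_N_iso_criterion:
  assumes "comm_group A" "comm_group B" and f: "f \<in> hom A B"
    and ker: "\<And>a. a \<in> carrier A \<Longrightarrow> f a = \<one>\<^bsub>B\<^esub> \<Longrightarrow> a [^]\<^bsub>A\<^esub> N = \<one>\<^bsub>A\<^esub>"
    and coker: "\<And>b. b \<in> carrier B \<Longrightarrow> \<exists>a\<in>carrier A. f a = b [^]\<^bsub>B\<^esub> (N * N)"
  shows "inv_N_iso N A B f"
  unfolding inv_N_iso_def
proof (intro conjI allI impI)
  interpret A: comm_group A by fact
  interpret B: comm_group B by fact
  interpret f: group_hom A B f
    by (intro group_hom.intro group_hom_axioms.intro) (rule f A.is_group B.is_group)+
  fix l :: nat assume l: "Factorial_Ring.prime l \<and> \<not> l dvd N"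
  let ?SA = "carrier A \<times> {s. \<not> l dvd s}" and ?SB = "carrier B \<times> {s. \<not> l dvd s}"
  have eA: "equiv ?SA (loc_rel A l)" and eB: "equiv ?SB (loc_rel B l)"
    using l assms equiv_loc_rel by blast+
  have not_dvd: "\<not> l dvd m * n" if "\<not> l dvd m" "\<not> l dvd n" for m n
    using that l by (simp add: prime_dvd_mult_iff)
  have f_rel: "((f a, s), (f b, u)) \<in> loc_rel B l" if "((a, s), (b, u)) \<in> loc_rel A l" for a s b u
    using that by (auto simp: loc_rel_def simp flip: f.hom_nat_pow)
  have map: "loc_map B l f (loc_rel A l `` {(a, s)}) = loc_rel B l `` {(f a, s)}"
    if "(a, s) \<in> ?SA" for a s
  proof -
    have "loc_rel B l `` {(f b, u)} = loc_rel B l `` {(f a, s)}"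
      if "((a, s), (b, u)) \<in> loc_rel A l" for b u
      using f_rel[OF that] eB by (metis equiv_class_eq)
    moreover have "((a, s), (a, s)) \<in> loc_rel A l"
      using that eA by (meson equiv_def refl_onD)
    ultimately show ?thesis unfolding loc_map_def by blast
  qed
  have inj: "((a, s), (b, u)) \<in> loc_rel A l"
    if S: "(a, s) \<in> ?SA" "(b, u) \<in> ?SA" and r: "((f a, s), (f b, u)) \<in> loc_rel B l" for a s b u
  proof -
    obtain v where v: "\<not> l dvd v" "f a [^]\<^bsub>B\<^esub> (u * v) = f b [^]\<^bsub>B\<^esub> (s * v)"
      using r by (auto simp: loc_rel_def)
    define x where "x = a [^]\<^bsub>A\<^esub> (u * v)"
    define y where "y = b [^]\<^bsub>A\<^esub> (s * v)"
    have xy: "x \<in> carrier A" "y \<in> carrier A" using S by (auto simp: x_def y_def)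
    have "f x = f y" using v S by (simp add: x_def y_def f.hom_nat_pow)
    then have "f (x \<otimes>\<^bsub>A\<^esub> inv\<^bsub>A\<^esub> y) = \<one>\<^bsub>B\<^esub>" using xy by simp
    then have "(x \<otimes>\<^bsub>A\<^esub> inv\<^bsub>A\<^esub> y) [^]\<^bsub>A\<^esub> N = \<one>\<^bsub>A\<^esub>" using xy by (intro ker) auto
    then have "x [^]\<^bsub>A\<^esub> N \<otimes>\<^bsub>A\<^esub> inv\<^bsub>A\<^esub> (y [^]\<^bsub>A\<^esub> N) = \<one>\<^bsub>A\<^esub>"
      using xy by (simp add: A.nat_pow_distrib A.nat_pow_inv)
    then have "x [^]\<^bsub>A\<^esub> N = y [^]\<^bsub>A\<^esub> N"
      using xy A.inv_equality[of "x [^]\<^bsub>A\<^esub> N" "inv\<^bsub>A\<^esub> (y [^]\<^bsub>A\<^esub> N)"] by simp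
    \<comment> \<open>The exponent N of the kernel is absorbed into the multiplier v N, still prime
      to l.\<close>
    then have "a [^]\<^bsub>A\<^esub> (u * (v * N)) = b [^]\<^bsub>A\<^esub> (s * (v * N))"
      using S by (simp add: x_def y_def A.nat_pow_pow ac_simps)
    then show ?thesis
      using S v(1) l not_dvd by (auto simp: loc_rel_def)
  qed
  have surj: "\<exists>a s. (a, s) \<in> ?SA \<and> ((f a, s), (b, u)) \<in> loc_rel B l" if bu: "(b, u) \<in> ?SB" for b u
  proof -
    obtain a where a: "a \<in> carrier A" "f a = b [^]\<^bsub>B\<^esub> (N * N)"
      using coker[of b] bu by auto
    \<comment> \<open>A preimage of b/u is a/(N^2 u).\<close>
    have "((f a, N * N * u), (b, u)) \<in> loc_rel B l"
      using a bu l not_dvd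
      by (auto simp: loc_rel_def B.nat_pow_pow ac_simps intro!: exI[of _ 1])
    moreover have "(a, N * N * u) \<in> ?SA" using a bu l not_dvd by auto
    ultimately show ?thesis by blast
  qed
  show "bij_betw (loc_map B l f) (loc_carrier A l) (loc_carrier B l)"
  proof (rule bij_betw_imageI)
    show "inj_on (loc_map B l f) (loc_carrier A l)"
    proof (rule inj_onI)
      fix C Y assume "C \<in> loc_carrier A l" "Y \<in> loc_carrier A l"
        and eq: "loc_map B l f C = loc_map B l f Y"
      then obtain a s b u where C: "C = loc_rel A l `` {(a, s)}" "(a, s) \<in> ?SA"
        and Y: "Y = loc_rel A l `` {(b, u)}" "(b, u) \<in> ?SA"
        unfolding loc_carrier_def by (metis quotientE surj_pair)
      have "(f a, s) \<in> ?SB" "(f b, u) \<in> ?SB" using C Y by auto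
      then have "((f a, s), (f b, u)) \<in> loc_rel B l"
        using eq map C Y eB by (metis eq_equiv_class)
      then show "C = Y"
        using inj C Y eA by (metis equiv_class_eq)
    qed
    show "loc_map B l f ` loc_carrier A l = loc_carrier B l"
    proof (intro equalityI subsetI)
      fix Y assume "Y \<in> loc_map B l f ` loc_carrier A l"
      then obtain a s where as: "(a, s) \<in> ?SA" "Y = loc_map B l f (loc_rel A l `` {(a, s)})"
        unfolding loc_carrier_def by (auto elim!: quotientE)
      then show "Y \<in> loc_carrier B l"
        unfolding loc_carrier_def by (auto simp: map intro!: quotientI)
    next
      fix Y assume "Y \<in> loc_carrier B l"
      then obtain b u where Y: "Y = loc_rel B l `` {(b, u)}" "(b, u) \<in> ?SB"
        unfolding loc_carrier_def by (auto elim!: quotientE)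
      then obtain a s where as: "(a, s) \<in> ?SA" "((f a, s), (b, u)) \<in> loc_rel B l"
        using surj by blast
      then have "Y = loc_map B l f (loc_rel A l `` {(a, s)})"
        using eB Y by (simp add: map) (metis equiv_class_eq)
      then show "Y \<in> loc_map B l f ` loc_carrier A l"
        using as(1) unfolding loc_carrier_def by (auto intro!: quotientI)
    qed
  qed
qed (rule f)

section \<open>The second homology and the kernel of the action\<close>

lemma (in bar_complex) subgroup_H2: "subgroup {a \<in> carrier A2. D a = (\<lambda>_. 0)} A2"
proof -
  interpret D: group_hom A2 "chain_group N 1" D
    by (intro group_hom.intro group_hom_axioms.intro) (rule D_hom A2.is_group group_chain_group)+
  have "{a \<in> carrier A2. D a = (\<lambda>_. 0)} = kernel A2 (chain_group N 1) D"
    by (simp add: kernel_def)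
  then show ?thesis using D.subgroup_kernel by simp
qed

lemma (in bar_complex) comm_group_H2: "comm_group H2"
  unfolding H2_def
  by (rule group.group_comm_groupI[OF A2.subgroup_imp_group[OF subgroup_H2]]) (simp add: A2.m_comm)

lemma (in bar_complex) H2_simps [simp]:
  "a \<otimes>\<^bsub>H2\<^esub> b = a \<otimes>\<^bsub>A2\<^esub> b" "\<one>\<^bsub>H2\<^esub> = \<one>\<^bsub>A2\<^esub>" "a [^]\<^bsub>H2\<^esub> (n::nat) = a [^]\<^bsub>A2\<^esub> n"
  by (simp_all add: H2_def nat_pow_def)

lemma (in bar_complex) carrier_H2: "carrier H2 = {a \<in> carrier A2. D a = (\<lambda>_. 0)}"
  by (simp add: H2_def)

context connected_quandle_on
begin

lemma H2_As_annihilated: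
  assumes "a \<in> carrier (group_homology G 2)"
  shows "a [^]\<^bsub>group_homology G 2\<^esub> t = \<one>\<^bsub>group_homology G 2\<^esub>"
proof -
  interpret bar: bar_complex G by (intro bar_complex.intro group_As)
  obtain \<sigma> where \<sigma>: "\<sigma> \<in> carrier G \<rightarrow> carrier bar.A2"
    and coh: "\<And>g h. g \<in> carrier G \<Longrightarrow> h \<in> carrier G \<Longrightarrow>
       bar.u g h [^]\<^bsub>bar.A2\<^esub> t \<otimes>\<^bsub>bar.A2\<^esub> \<sigma> (g \<otimes>\<^bsub>G\<^esub> h) = \<sigma> g \<otimes>\<^bsub>bar.A2\<^esub> \<sigma> h"
    using type_splitting[OF bar.comm_group_A2 bar.u_cocycle] by metis
  have a: "a \<in> carrier bar.H2" using assms by (simp add: bar.group_homology_2)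
  have "a [^]\<^bsub>bar.A2\<^esub> t = \<one>\<^bsub>bar.A2\<^esub>"
  proof (rule bar.lift_D_eq[where \<phi> = \<sigma> and h = "\<lambda>a. a [^]\<^bsub>bar.A2\<^esub> t" and h' = "\<lambda>_. \<one>\<^bsub>bar.A2\<^esub>"])
    show "(\<lambda>a. a [^]\<^bsub>bar.A2\<^esub> t) \<in> hom bar.A2 bar.A2"
      by (rule homI) (simp_all add: bar.A2.nat_pow_distrib)
    show "(\<lambda>_. \<one>\<^bsub>bar.A2\<^esub>) \<in> hom bar.A2 bar.A2" by (simp add: hom_def)
    show "a \<in> carrier bar.H2" by fact
    show "comm_group bar.A2" by (rule bar.comm_group_A2)
    show "\<sigma> x \<in> carrier bar.A2" if "x \<in> carrier G" for x using \<sigma> that by auto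
    then show "bar.u x y [^]\<^bsub>bar.A2\<^esub> t \<otimes>\<^bsub>bar.A2\<^esub> \<sigma> (x \<otimes>\<^bsub>G\<^esub> y)
        = \<one>\<^bsub>bar.A2\<^esub> \<otimes>\<^bsub>bar.A2\<^esub> (\<sigma> x \<otimes>\<^bsub>bar.A2\<^esub> \<sigma> y)"
      if "x \<in> carrier G" "y \<in> carrier G" for x y
      using coh[OF that] that by simp
  qed
  then show ?thesis by (simp add: bar.group_homology_2)
qed

text \<open>Connectedness makes the generators conjugate, and conjugate elements have the same image
  in an abelian group.\<close>

lemma gen_hom_const:
  assumes "comm_group B" "\<eta> \<in> hom G B" "x \<in> Q" "y \<in> Q"
  shows "\<eta> (gen x) = \<eta> (gen y)"
proof -
  interpret B: comm_group B by fact
  interpret \<eta>: group_hom G B \<eta>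
    by (intro group_hom.intro group_hom_axioms.intro group_As assms(2) B.is_group)
  obtain g where g: "g \<in> carrier G" "gen y = inv\<^bsub>G\<^esub> g \<otimes>\<^bsub>G\<^esub> gen x \<otimes>\<^bsub>G\<^esub> g"
    using assms(3,4) by (rule gen_conj)
  show ?thesis
    unfolding g(2) using g(1) assms(3) by (simp add: B.m_comm[of _ "\<eta> g"] B.mult_inv_cancel B.m_assoc[symmetric])
qed

lemma degree_exists: "\<exists>d. d \<in> hom G integer_group \<and> (\<forall>x\<in>Q. d (gen x) = 1)"
  by (rule As_universal[OF group_integer_group, of "\<lambda>_. 1"]) auto

text \<open>The exponent sum of a representing word; by \<open>hom_deg\<close> it is the
  abelianisation of As(X).\<close>

definition deg where "deg = (SOME d. d \<in> hom G integer_group \<and> (\<forall>x\<in>Q. d (gen x) = 1))"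

lemma deg_hom: "deg \<in> hom G integer_group" and deg_gen: "x \<in> Q \<Longrightarrow> deg (gen x) = 1"
  using someI_ex[OF degree_exists] unfolding deg_def[symmetric] by blast+

lemma hom_deg:
  assumes "comm_group B" "\<eta> \<in> hom G B" "x \<in> Q" "g \<in> carrier G"
  shows "\<eta> g = \<eta> (gen x) [^]\<^bsub>B\<^esub> deg g"
proof -
  interpret B: comm_group B by fact
  have y: "\<eta> (gen x) \<in> carrier B" using assms(2,3) by (auto simp: hom_def)
  have "(\<lambda>g. \<eta> (gen x) [^]\<^bsub>B\<^esub> deg g) \<in> hom G B"
    using y by (intro homI) (auto simp: hom_mult[OF deg_hom] B.int_pow_mult)
  moreover have "\<eta> (gen z) = \<eta> (gen x) [^]\<^bsub>B\<^esub> deg (gen z)" if "z \<in> Q" for z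
    using gen_hom_const[OF assms(1,2) that assms(3)] y that by (simp add: deg_gen)
  ultimately show ?thesis
    using hom_eq_on_gen[OF assms(2) _ B.is_group] assms(4) by blast
qed

section \<open>As(X) as a central extension of Inn(X)\<close>

abbreviation K where "K \<equiv> Ker_psi Q qop"
abbreviation I where "I \<equiv> Inn Q qop"

text \<open>An element fixing every point x conjugates every e_x to itself, by
  \<open>gen_word_act\<close>.\<close>

lemma K_central:
  assumes "k \<in> carrier K" "g \<in> carrier G"
  shows "g \<otimes>\<^bsub>G\<^esub> k = k \<otimes>\<^bsub>G\<^esub> g"
proof (rule central_if_commutes_gen[OF _ _ assms(2)])
  show k: "k \<in> carrier G" using assms(1) by (simp add: Ker_psi_def)
  fix x assume x: "x \<in> Q"
  obtain w where w: "w \<in> words Q" "k = wcl w" using k by (rule carrier_AsE)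
  have "(\<lambda>x\<in>Q. word_act Q qop x w) x = (\<lambda>x\<in>Q. x) x"
    using assms(1) w by (simp add: Ker_psi_def psi_wcl)
  then have "word_act Q qop x w = x" using x by simp
  then have "gen x = inv\<^bsub>G\<^esub> k \<otimes>\<^bsub>G\<^esub> gen x \<otimes>\<^bsub>G\<^esub> k"
    using gen_word_act[OF x w(1)] w(2) by simp
  then have "k \<otimes>\<^bsub>G\<^esub> gen x = k \<otimes>\<^bsub>G\<^esub> (inv\<^bsub>G\<^esub> k \<otimes>\<^bsub>G\<^esub> gen x \<otimes>\<^bsub>G\<^esub> k)" by simp
  then show "gen x \<otimes>\<^bsub>G\<^esub> k = k \<otimes>\<^bsub>G\<^esub> gen x"
    using k x by (simp add: G.m_assoc G.mult_inv_cancel)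
qed

lemma subgroup_K: "subgroup (carrier K) G"
proof -
  interpret p: group_hom G I pr
    by (intro group_hom.intro group_hom_axioms.intro group_As group_Inn pr_hom)
  show ?thesis
    using p.subgroup_kernel by (simp add: kernel_def carrier_Ker_psi)
qed

lemma K_eq: "K = G\<lparr>carrier := carrier K\<rparr>"
  by (simp add: Ker_psi_def)

lemma K_simps [simp]: "a \<otimes>\<^bsub>K\<^esub> b = a \<otimes>\<^bsub>G\<^esub> b" "\<one>\<^bsub>K\<^esub> = \<one>\<^bsub>G\<^esub>" "a [^]\<^bsub>K\<^esub> (n::nat) = a [^]\<^bsub>G\<^esub> n"
  by (simp_all add: Ker_psi_def nat_pow_def)

lemma K_in_G: "k \<in> carrier K \<Longrightarrow> k \<in> carrier G"
  by (simp add: Ker_psi_def)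

lemma comm_group_K: "comm_group K"
proof -
  have "group K" using G.subgroup_imp_group[OF subgroup_K] by (simp flip: K_eq)
  then show ?thesis
    by (rule group.group_comm_groupI) (simp add: K_central K_in_G)
qed

lemma gen_pow_type_in_K:
  assumes "x \<in> Q"
  shows "gen x [^]\<^bsub>G\<^esub> t \<in> carrier K"
proof -
  have psi_gen: "psi Q qop (gen x) = (\<lambda>y\<in>Q. qop y x)"
    using assms by (simp add: gen_def psi_wcl)
  have "psi Q qop (gen x [^]\<^bsub>G\<^esub> n) = (\<lambda>y\<in>Q. ((\<lambda>z. qop z x) ^^ n) y)
      \<and> (\<forall>y\<in>Q. ((\<lambda>z. qop z x) ^^ n) y \<in> Q)" for n
  proof (induction n)
    case (Suc n)
    then show ?case
      using assms by (auto simp: psi_mult psi_gen compose_def qop_closed)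
  qed (simp add: psi_one)
  then have "psi Q qop (gen x [^]\<^bsub>G\<^esub> t) = (\<lambda>y\<in>Q. y)"
    using type_id[OF _ assms] by (auto cong: restrict_cong)
  then show ?thesis using assms by (simp add: Ker_psi_def)
qed

text \<open>Normalised at 1, so that \<open>rho\<close> is the identity on \<open>K\<close> and the
  factor set is trivial at (1, 1).\<close>

definition sec where
  "sec m = (if m = \<one>\<^bsub>I\<^esub> then \<one>\<^bsub>G\<^esub> else SOME g. g \<in> carrier G \<and> pr g = m)"

lemma sec:
  assumes "m \<in> carrier I"
  shows sec_in: "sec m \<in> carrier G" and pr_sec: "pr (sec m) = m"
proof -
  interpret p: group_hom G I pr
    by (intro group_hom.intro group_hom_axioms.intro group_As group_Inn pr_hom)
  have "m \<in> pr ` carrier G" using assms by (simp add: pr_surj)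
  then have "\<exists>g. g \<in> carrier G \<and> pr g = m" by blast
  then have "(SOME g. g \<in> carrier G \<and> pr g = m) \<in> carrier G \<and> pr (SOME g. g \<in> carrier G \<and> pr g = m) = m"
    by (rule someI_ex)
  then show "sec m \<in> carrier G" "pr (sec m) = m"
    by (simp_all add: sec_def p.hom_one)
qed

text \<open>The factor set of the extension of Inn(X) by \<open>K\<close>.\<close>

definition sec_coc where
  "sec_coc m n = sec m \<otimes>\<^bsub>G\<^esub> sec n \<otimes>\<^bsub>G\<^esub> inv\<^bsub>G\<^esub> (sec (m \<otimes>\<^bsub>I\<^esub> n))"

lemma sec_coc_in:
  assumes "m \<in> carrier I" "n \<in> carrier I"
  shows "sec_coc m n \<in> carrier K"
proof -
  interpret p: group_hom G I pr
    by (intro group_hom.intro group_hom_axioms.intro group_As group_Inn pr_hom)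
  show ?thesis
    using assms by (simp add: carrier_Ker_psi sec_coc_def sec_in pr_sec)
qed

lemma sec_mult:
  assumes "m \<in> carrier I" "n \<in> carrier I"
  shows "sec m \<otimes>\<^bsub>G\<^esub> sec n = sec_coc m n \<otimes>\<^bsub>G\<^esub> sec (m \<otimes>\<^bsub>I\<^esub> n)"
proof -
  interpret I: group I by (rule group_Inn)
  show ?thesis using assms by (simp add: sec_coc_def sec_in G.m_assoc)
qed

text \<open>Both bracketings of sec x sec y sec z are compared; centrality of \<open>K\<close> moves
  the factor for (y, z) past sec x.\<close>

lemma sec_cocycle: "cocycle I K sec_coc"
  unfolding cocycle_def
proof (intro conjI ballI)
  interpret I: group I by (rule group_Inn)
  fix x y z assume xyz: "x \<in> carrier I" "y \<in> carrier I" "z \<in> carrier I"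
  let ?xyz = "sec (x \<otimes>\<^bsub>I\<^esub> (y \<otimes>\<^bsub>I\<^esub> z))"
  have c: "sec_coc a b \<in> carrier G" if "a \<in> carrier I" "b \<in> carrier I" for a b
    using sec_coc_in[OF that] by (rule K_in_G)
  have "sec_coc x y \<otimes>\<^bsub>G\<^esub> sec_coc (x \<otimes>\<^bsub>I\<^esub> y) z \<otimes>\<^bsub>G\<^esub> ?xyz = sec_coc x y \<otimes>\<^bsub>G\<^esub> (sec (x \<otimes>\<^bsub>I\<^esub> y) \<otimes>\<^bsub>G\<^esub> sec z)"
    using xyz by (simp add: sec_mult G.m_assoc c sec_in I.m_assoc)
  also have "\<dots> = sec x \<otimes>\<^bsub>G\<^esub> (sec y \<otimes>\<^bsub>G\<^esub> sec z)"
    using xyz by (simp add: G.m_assoc[symmetric] sec_in c sec_mult[of x y])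
  also have "\<dots> = sec x \<otimes>\<^bsub>G\<^esub> sec_coc y z \<otimes>\<^bsub>G\<^esub> sec (y \<otimes>\<^bsub>I\<^esub> z)"
    using xyz by (simp add: sec_mult[of y z] G.m_assoc sec_in c)
  also have "\<dots> = sec_coc y z \<otimes>\<^bsub>G\<^esub> (sec x \<otimes>\<^bsub>G\<^esub> sec (y \<otimes>\<^bsub>I\<^esub> z))"
    using xyz by (simp add: K_central[OF sec_coc_in] G.m_assoc sec_in c)
  also have "\<dots> = sec_coc y z \<otimes>\<^bsub>G\<^esub> sec_coc x (y \<otimes>\<^bsub>I\<^esub> z) \<otimes>\<^bsub>G\<^esub> ?xyz"
    using xyz by (simp add: sec_mult[of x "y \<otimes>\<^bsub>I\<^esub> z"] G.m_assoc sec_in c)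
  finally show "sec_coc x y \<otimes>\<^bsub>K\<^esub> sec_coc (x \<otimes>\<^bsub>I\<^esub> y) z = sec_coc y z \<otimes>\<^bsub>K\<^esub> sec_coc x (y \<otimes>\<^bsub>I\<^esub> z)"
    using xyz c sec_in by simp
qed (rule sec_coc_in)

text \<open>The \<open>K\<close>-coordinate of g in g = sec(pr g) rho(g).\<close>

definition rho where "rho g = inv\<^bsub>G\<^esub> (sec (pr g)) \<otimes>\<^bsub>G\<^esub> g"

lemma rho_in:
  assumes "g \<in> carrier G"
  shows "rho g \<in> carrier K"
proof -
  interpret p: group_hom G I pr
    by (intro group_hom.intro group_hom_axioms.intro group_As group_Inn pr_hom)
  show ?thesis using assms by (simp add: carrier_Ker_psi rho_def sec_in pr_sec)
qed

text \<open>Pulled back to As(X), the factor set becomes a coboundary, witnessed by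
  \<open>rho\<close>. The sign is opposite to that in \<open>type_splitting\<close>, so that the two
  can be made to cancel.\<close>

lemma rho_mult:
  assumes "g \<in> carrier G" "h \<in> carrier G"
  shows "rho (g \<otimes>\<^bsub>G\<^esub> h) = sec_coc (pr g) (pr h) \<otimes>\<^bsub>G\<^esub> (rho g \<otimes>\<^bsub>G\<^esub> rho h)"
proof -
  interpret p: group_hom G I pr
    by (intro group_hom.intro group_hom_axioms.intro group_As group_Inn pr_hom)
  let ?sg = "sec (pr g)" and ?sh = "sec (pr h)" and ?s = "sec (pr g \<otimes>\<^bsub>I\<^esub> pr h)"
  let ?k = "sec_coc (pr g) (pr h)"
  have i: "?sg \<in> carrier G" "?sh \<in> carrier G" "?s \<in> carrier G" "?k \<in> carrier K" "?k \<in> carrier G"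
    "rho g \<in> carrier G" "rho h \<in> carrier G"
    using assms sec_coc_in rho_in K_in_G by (simp_all add: sec_in)
  have "g \<otimes>\<^bsub>G\<^esub> h = ?sg \<otimes>\<^bsub>G\<^esub> (rho g \<otimes>\<^bsub>G\<^esub> ?sh) \<otimes>\<^bsub>G\<^esub> rho h"
    using assms i by (simp add: rho_def G.m_assoc G.mult_inv_cancel)
  also have "\<dots> = (?sg \<otimes>\<^bsub>G\<^esub> ?sh) \<otimes>\<^bsub>G\<^esub> (rho g \<otimes>\<^bsub>G\<^esub> rho h)"
    unfolding K_central[OF rho_in[OF assms(1)] i(2), symmetric] using i by (simp add: G.m_assoc)
  also have "\<dots> = ?s \<otimes>\<^bsub>G\<^esub> (?k \<otimes>\<^bsub>G\<^esub> (rho g \<otimes>\<^bsub>G\<^esub> rho h))"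
    using assms i K_central[OF i(4), of ?s] by (simp add: sec_mult G.m_assoc[symmetric])
  finally have gh: "g \<otimes>\<^bsub>G\<^esub> h = ?s \<otimes>\<^bsub>G\<^esub> (?k \<otimes>\<^bsub>G\<^esub> (rho g \<otimes>\<^bsub>G\<^esub> rho h))" .
  have "rho (g \<otimes>\<^bsub>G\<^esub> h) = inv\<^bsub>G\<^esub> ?s \<otimes>\<^bsub>G\<^esub> (g \<otimes>\<^bsub>G\<^esub> h)"
    using assms by (simp add: rho_def)
  then show ?thesis
    unfolding gh using i by (simp add: G.inv_mult_cancel)
qed

lemma rho_K: "k \<in> carrier K \<Longrightarrow> rho k = k"
  by (simp add: rho_def carrier_Ker_psi sec_def)

lemma sec_coc_one: "sec_coc \<one>\<^bsub>I\<^esub> \<one>\<^bsub>I\<^esub> = \<one>\<^bsub>G\<^esub>"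
proof -
  interpret I: group I by (rule group_Inn)
  show ?thesis by (simp add: sec_coc_def sec_def)
qed

end

section \<open>The comparison map from the kernel of the action to Z + H_2(Inn(X))\<close>

context connected_quandle_on
begin

theorem Ker_psi_inv_iso: "inv_N_isomorphic t K (integer_group \<times>\<times> group_homology I 2)"
proof -
  interpret I: group I by (rule group_Inn)
  interpret bar: bar_complex I by (intro bar_complex.intro group_Inn)
  interpret K: comm_group K by (rule comm_group_K)
  interpret H: comm_group bar.H2 by (rule bar.comm_group_H2)
  interpret p: group_hom G I pr
    by (intro group_hom.intro group_hom_axioms.intro group_As group_Inn pr_hom)
  interpret deg: group_hom G integer_group deg
    by (intro group_hom.intro group_hom_axioms.intro group_As group_integer_group deg_hom)
  interpret D: group_hom bar.A2 "chain_group I 1" bar.D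
    by (intro group_hom.intro group_hom_axioms.intro) (rule bar.D_hom bar.A2.is_group group_chain_group)+
  obtain x0 where x0: "x0 \<in> Q" using nonempty by auto
  let ?A = bar.A2
  define f where "f g h = bar.u (pr g) (pr h)" for g h
  have f_in: "f g h \<in> carrier ?A" if "g \<in> carrier G" "h \<in> carrier G" for g h
    using that by (simp add: f_def bar.u_in)
  have f_coc: "cocycle G ?A f"
    using bar.u_cocycle by (simp add: cocycle_def f_def)
  obtain \<sigma> where \<sigma>0: "\<sigma> \<in> carrier G \<rightarrow> carrier ?A"
    and coh: "\<And>g h. g \<in> carrier G \<Longrightarrow> h \<in> carrier G \<Longrightarrow>
       f g h [^]\<^bsub>?A\<^esub> t \<otimes>\<^bsub>?A\<^esub> \<sigma> (g \<otimes>\<^bsub>G\<^esub> h) = \<sigma> g \<otimes>\<^bsub>?A\<^esub> \<sigma> h"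
    and \<sigma>_gen: "\<And>x. x \<in> Q \<Longrightarrow> \<sigma> (gen x) = power_defect G ?A f (gen x) t"
    using type_splitting[OF bar.comm_group_A2 f_coc] by metis
  have \<sigma> [simp]: "\<sigma> g \<in> carrier ?A" if "g \<in> carrier G" for g using \<sigma>0 that by auto
  have D_in: "bar.D a \<in> chains I 1" if "a \<in> carrier ?A" for a
    using D.hom_closed[OF that] by simp
  have D_pow: "bar.D (a [^]\<^bsub>?A\<^esub> (n::nat)) = (\<lambda>zs. int n * bar.D a zs)" if "a \<in> carrier ?A" for a n
  proof -
    have "bar.D (a [^]\<^bsub>?A\<^esub> int n) = bar.D a [^]\<^bsub>chain_group I 1\<^esub> int n"
      using that by (rule D.hom_int_pow)
    then show ?thesis
      using int_pow_chain_group[OF D_in[OF that], of "int n"] by (simp add: int_pow_int)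
  qed
  have pr_K: "pr k = \<one>\<^bsub>I\<^esub>" if "k \<in> carrier K" for k using that by (simp add: carrier_Ker_psi)
  \<comment> \<open>This decides that \<open>F\<close> lands in H_2. Applying D to the relation for
    \<sigma> shows that the difference \<delta> of the two sides is a homomorphism on As(X), so it
    only has to vanish on generators.\<close>
  have D_\<sigma>: "bar.D (\<sigma> g) = (\<lambda>zs. int t * single [pr g] zs)" if g: "g \<in> carrier G" for g
  proof -
    define \<delta> where "\<delta> g = (\<lambda>zs. bar.D (\<sigma> g) zs - int t * single [pr g] zs)" for g
    have s: "(\<lambda>zs. int t * single [pr g] zs) \<in> chains I 1" if "g \<in> carrier G" for g
      using that by (intro chains_scale single_chain) auto
    have \<delta>_hom: "\<delta> \<in> hom G (chain_group I 1)"
    proof (rule homI)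
      fix g assume "g \<in> carrier G"
      then show "\<delta> g \<in> carrier (chain_group I 1)"
        unfolding \<delta>_def chain_group_simps by (intro bar.chains_diff D_in s \<sigma>)
    next
      fix g h assume gh: "g \<in> carrier G" "h \<in> carrier G"
      have "bar.D (f g h [^]\<^bsub>?A\<^esub> t \<otimes>\<^bsub>?A\<^esub> \<sigma> (g \<otimes>\<^bsub>G\<^esub> h)) = bar.D (\<sigma> g \<otimes>\<^bsub>?A\<^esub> \<sigma> h)"
        using coh[OF gh] by simp
      then have "(\<lambda>zs. int t * bar.D (f g h) zs + bar.D (\<sigma> (g \<otimes>\<^bsub>G\<^esub> h)) zs)
          = (\<lambda>zs. bar.D (\<sigma> g) zs + bar.D (\<sigma> h) zs)"
        using gh f_in by (simp add: D_pow)
      then have "int t * (single [pr h] zs - single [pr (g \<otimes>\<^bsub>G\<^esub> h)] zs + single [pr g] zs)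
          + bar.D (\<sigma> (g \<otimes>\<^bsub>G\<^esub> h)) zs = bar.D (\<sigma> g) zs + bar.D (\<sigma> h) zs" for zs
        using gh by (simp add: f_def bar.D_u fun_eq_iff)
      then show "\<delta> (g \<otimes>\<^bsub>G\<^esub> h) = \<delta> g \<otimes>\<^bsub>chain_group I 1\<^esub> \<delta> h"
        by (auto simp: \<delta>_def algebra_simps fun_eq_iff)
    qed
    have zero_hom: "(\<lambda>_ _. 0) \<in> hom G (chain_group I 1)" by (simp add: hom_def)
    have "\<delta> (gen x) = (\<lambda>_. 0)" if x: "x \<in> Q" for x
    proof -
      have pd: "power_defect G ?A f (gen x) n \<in> carrier ?A" for n
        using x by (induction n) (auto simp: f_in)
      \<comment> \<open>With p = pr(e_x) this is the telescoping sum of [p] - [p^{i+1}] + [p^i] over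
        i < n. For n = \<open>t\<close> the last two terms cancel, because p^t = 1.\<close>
      have "bar.D (power_defect G ?A f (gen x) n)
          = (\<lambda>zs. int n * single [pr (gen x)] zs + single [\<one>\<^bsub>I\<^esub>] zs - single [pr (gen x [^]\<^bsub>G\<^esub> n)] zs)" for n
      proof (induction n)
        case 0
        then show ?case using D.hom_one by simp
      next
        case (Suc n)
        have "bar.D (f (gen x [^]\<^bsub>G\<^esub> n) (gen x)) = (\<lambda>zs. single [pr (gen x)] zs
            - single [pr (gen x [^]\<^bsub>G\<^esub> Suc n)] zs + single [pr (gen x [^]\<^bsub>G\<^esub> n)] zs)"
          using x by (simp add: f_def bar.D_u del: p.hom_nat_pow)
        then show ?case
          using x pd Suc f_in by (simp add: algebra_simps del: nat_pow_Suc)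
      qed
      then show ?thesis
        using x by (simp add: \<delta>_def \<sigma>_gen pr_K[OF gen_pow_type_in_K] del: p.hom_nat_pow)
    qed
    then have "\<delta> g = (\<lambda>_. 0)"
      using hom_eq_on_gen[OF \<delta>_hom zero_hom group_chain_group _ g] by simp
    then show ?thesis by (simp add: \<delta>_def fun_eq_iff)
  qed
  have u11: "bar.u \<one>\<^bsub>I\<^esub> \<one>\<^bsub>I\<^esub> \<in> carrier ?A" by (simp add: bar.u_in)
  \<comment> \<open>The constant by which \<sigma> fails to be additive on \<open>K\<close>: there
    \<open>f\<close> has the constant value u(1, 1), as pr is trivial. Moreover D w = t[1], which
    equals D(\<sigma> k) for k in \<open>K\<close>; so the same correction makes \<open>F\<close>
    additive and puts it in the kernel of D.\<close>
  define w where "w = bar.u \<one>\<^bsub>I\<^esub> \<one>\<^bsub>I\<^esub> [^]\<^bsub>?A\<^esub> t"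
  have w [simp]: "w \<in> carrier ?A" using u11 by (simp add: w_def)
  define F where "F k = \<sigma> k \<otimes>\<^bsub>?A\<^esub> inv\<^bsub>?A\<^esub> w" for k
  have F_in: "F k \<in> carrier ?A" if "k \<in> carrier K" for k
    using that K_in_G by (simp add: F_def)
  have F_w: "F k \<otimes>\<^bsub>?A\<^esub> w = \<sigma> k" if "k \<in> carrier K" for k
    using that K_in_G by (simp add: F_def bar.A2.m_assoc)
  \<comment> \<open>Translation by \<open>K\<close> changes \<sigma> by \<open>F\<close>. With g in
    \<open>K\<close> this gives additivity of \<open>F\<close>; with g a value of \<open>sec\<close>
    it enters \<open>F_\<kappa>\<close>.\<close>
  have F_left: "F k \<otimes>\<^bsub>?A\<^esub> \<sigma> g = \<sigma> (k \<otimes>\<^bsub>G\<^esub> g)" if k: "k \<in> carrier K" and g: "g \<in> carrier G" for k g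
  proof -
    have kG: "k \<in> carrier G" using k by (rule K_in_G)
    have "f k g = bar.u \<one>\<^bsub>I\<^esub> \<one>\<^bsub>I\<^esub>"
      using cocycle_one_left[OF group_Inn bar.comm_group_A2 bar.u_cocycle, of "pr g"] g
      by (simp add: f_def pr_K[OF k])
    then have "F k \<otimes>\<^bsub>?A\<^esub> \<sigma> g = inv\<^bsub>?A\<^esub> w \<otimes>\<^bsub>?A\<^esub> (w \<otimes>\<^bsub>?A\<^esub> \<sigma> (k \<otimes>\<^bsub>G\<^esub> g))"
      using coh[OF kG g] kG g by (simp add: w_def[symmetric] F_def bar.A2.m_ac)
    then show ?thesis using kG g by (simp add: bar.A2.inv_mult_cancel)
  qed
  have F_hom: "F \<in> hom K ?A"
  proof (rule homI)
    fix k k' assume k: "k \<in> carrier K" "k' \<in> carrier K"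
    have "F (k \<otimes>\<^bsub>G\<^esub> k') = F k \<otimes>\<^bsub>?A\<^esub> \<sigma> k' \<otimes>\<^bsub>?A\<^esub> inv\<^bsub>?A\<^esub> w"
      using F_left[OF k(1)] k K_in_G by (simp add: F_def[of "k \<otimes>\<^bsub>G\<^esub> k'"])
    then show "F (k \<otimes>\<^bsub>K\<^esub> k') = F k \<otimes>\<^bsub>?A\<^esub> F k'"
      using k F_in K_in_G by (simp add: F_def[of k'] bar.A2.m_assoc)
  qed (rule F_in)
  have F_H2: "F k \<in> carrier bar.H2" if k: "k \<in> carrier K" for k
  proof -
    have "bar.D (F k \<otimes>\<^bsub>?A\<^esub> w) = (\<lambda>zs. int t * single [\<one>\<^bsub>I\<^esub>] zs)"
      using k by (simp add: F_w D_\<sigma> K_in_G pr_K)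
    moreover have "bar.D w = (\<lambda>zs. int t * single [\<one>\<^bsub>I\<^esub>] zs)"
      using u11 by (simp add: w_def D_pow bar.D_u)
    ultimately show ?thesis
      using F_in[OF k] by (simp add: bar.carrier_H2 fun_eq_iff)
  qed
  \<comment> \<open>\<kappa> classifies the factor set. Its restriction to H_2(Inn(X)) is, up to
    sign, the map to \<open>K\<close> in the five-term exact sequence.\<close>
  obtain \<kappa> where \<kappa>: "\<kappa> \<in> hom ?A K"
    and \<kappa>_u: "\<And>x y. x \<in> carrier I \<Longrightarrow> y \<in> carrier I \<Longrightarrow> \<kappa> (bar.u x y) = sec_coc x y"
    using bar.A2_universal[OF comm_group_K sec_cocycle] by metis
  interpret \<kappa>: group_hom ?A K \<kappa>
    by (intro group_hom.intro group_hom_axioms.intro) (rule \<kappa> bar.A2.is_group K.is_group)+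
  interpret F: group_hom K ?A F
    by (intro group_hom.intro group_hom_axioms.intro) (rule F_hom bar.A2.is_group K.is_group)+
  have ker: "k [^]\<^bsub>G\<^esub> t = \<one>\<^bsub>G\<^esub>" if k: "k \<in> carrier K" "deg k = 0" "F k = \<one>\<^bsub>?A\<^esub>" for k
  proof -
    \<comment> \<open>The failures of \<kappa> \<sigma> and of the t-th power of \<open>rho\<close>
      to be additive are t times the factor set with opposite signs, so \<theta> is a homomorphism
      to an abelian group and depends on the degree only. On \<open>K\<close> it equals
      \<kappa>(\<sigma> k) k^t; if F k is trivial then \<sigma> k = w, which \<kappa> kills since
      \<open>sec_coc\<close> is trivial at (1, 1).\<close>
    define \<theta> where "\<theta> g = \<kappa> (\<sigma> g) \<otimes>\<^bsub>K\<^esub> rho g [^]\<^bsub>K\<^esub> t" for g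
    have "\<theta> \<in> hom G K"
    proof (rule homI)
      fix g assume "g \<in> carrier G"
      then show "\<theta> g \<in> carrier K"
        unfolding \<theta>_def by (intro K.m_closed K.nat_pow_closed \<kappa>.hom_closed \<sigma> rho_in)
    next
      fix g h assume gh: "g \<in> carrier G" "h \<in> carrier G"
      let ?k = "sec_coc (pr g) (pr h)"
      have i: "?k \<in> carrier K" "rho g \<in> carrier K" "rho h \<in> carrier K"
        "\<kappa> (\<sigma> g) \<in> carrier K" "\<kappa> (\<sigma> h) \<in> carrier K" "\<kappa> (\<sigma> (g \<otimes>\<^bsub>G\<^esub> h)) \<in> carrier K"
        using gh by (auto intro: sec_coc_in rho_in \<kappa>.hom_closed)
      have "\<kappa> (f g h [^]\<^bsub>?A\<^esub> t \<otimes>\<^bsub>?A\<^esub> \<sigma> (g \<otimes>\<^bsub>G\<^esub> h)) = \<kappa> (\<sigma> g \<otimes>\<^bsub>?A\<^esub> \<sigma> h)"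
        using coh[OF gh] by simp
      then have 1: "?k [^]\<^bsub>K\<^esub> t \<otimes>\<^bsub>K\<^esub> \<kappa> (\<sigma> (g \<otimes>\<^bsub>G\<^esub> h)) = \<kappa> (\<sigma> g) \<otimes>\<^bsub>K\<^esub> \<kappa> (\<sigma> h)"
        using gh f_in \<kappa>_u[of "pr g" "pr h"] by (simp add: \<kappa>.hom_nat_pow f_def bar.u_in del: K_simps)
      have 2: "rho (g \<otimes>\<^bsub>G\<^esub> h) = ?k \<otimes>\<^bsub>K\<^esub> (rho g \<otimes>\<^bsub>K\<^esub> rho h)"
        using rho_mult[OF gh] by simp
      have "\<theta> (g \<otimes>\<^bsub>G\<^esub> h)
          = (?k [^]\<^bsub>K\<^esub> t \<otimes>\<^bsub>K\<^esub> \<kappa> (\<sigma> (g \<otimes>\<^bsub>G\<^esub> h))) \<otimes>\<^bsub>K\<^esub> (rho g [^]\<^bsub>K\<^esub> t \<otimes>\<^bsub>K\<^esub> rho h [^]\<^bsub>K\<^esub> t)"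
        unfolding \<theta>_def 2 using i by (simp add: K.nat_pow_distrib K.m_ac del: K_simps)
      also have "\<dots> = \<theta> g \<otimes>\<^bsub>K\<^esub> \<theta> h"
        unfolding \<theta>_def 1 using i by (simp add: K.m_ac del: K_simps)
      finally show "\<theta> (g \<otimes>\<^bsub>G\<^esub> h) = \<theta> g \<otimes>\<^bsub>K\<^esub> \<theta> h" .
    qed
    then have "\<theta> k = \<one>\<^bsub>K\<^esub>"
      using hom_deg[OF comm_group_K _ x0 K_in_G[OF k(1)]] k(2) by (simp del: K_simps)
    moreover have "\<sigma> k = w" using F_w[OF k(1)] k(3) by simp
    moreover have "\<kappa> w = \<one>\<^bsub>K\<^esub>"
      using u11 by (simp add: w_def \<kappa>.hom_nat_pow \<kappa>_u sec_coc_one)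
    ultimately show ?thesis
      using k(1) K_in_G by (simp add: \<theta>_def rho_K)
  qed
  have deg_K: "deg \<in> hom K integer_group"
    using deg_hom by (simp add: hom_def K_in_G)
  \<comment> \<open>The degree of the factor set is the coboundary of the integer cochain
    \<open>deg\<close> of \<open>sec\<close> on Inn(X), hence invisible on H_2.\<close>
  have deg_\<kappa>: "deg (\<kappa> a) = 0" if a: "a \<in> carrier bar.H2" for a
  proof -
    have "(deg \<circ> \<kappa>) a = (\<lambda>_. 0) a"
    proof (rule bar.lift_D_eq[where \<phi> = "\<lambda>m. deg (sec m)" and h = "deg \<circ> \<kappa>" and h' = "\<lambda>_. 0"])
      show "deg \<circ> \<kappa> \<in> hom ?A integer_group" using \<kappa> deg_K by (rule Group.hom_compose)
      show "(\<lambda>_. 0) \<in> hom ?A integer_group" by (simp add: hom_def)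
      fix x y assume xy: "x \<in> carrier I" "y \<in> carrier I"
      have "deg (sec x \<otimes>\<^bsub>G\<^esub> sec y) = deg (sec_coc x y \<otimes>\<^bsub>G\<^esub> sec (x \<otimes>\<^bsub>I\<^esub> y))"
        using sec_mult[OF xy] by simp
      then show "(deg \<circ> \<kappa>) (bar.u x y) \<otimes>\<^bsub>integer_group\<^esub> deg (sec (x \<otimes>\<^bsub>I\<^esub> y))
          = 0 \<otimes>\<^bsub>integer_group\<^esub> (deg (sec x) \<otimes>\<^bsub>integer_group\<^esub> deg (sec y))"
        using xy by (simp add: \<kappa>_u sec_in sec_coc_in K_in_G)
    qed (use a abelian_integer_group in auto)
    then show ?thesis by simp
  qed
  \<comment> \<open>The relation for \<sigma> at (sec x, sec y), rewritten by \<open>F_left\<close>,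
    says that F \<kappa> + t is on pairs the coboundary of \<sigma> \<open>sec\<close>.\<close>
  have F_\<kappa>: "F (\<kappa> a) \<otimes>\<^bsub>?A\<^esub> a [^]\<^bsub>?A\<^esub> t = \<one>\<^bsub>?A\<^esub>" if a: "a \<in> carrier bar.H2" for a
  proof (rule bar.lift_D_eq[where \<phi> = "\<lambda>m. \<sigma> (sec m)" and h = "\<lambda>a. F (\<kappa> a) \<otimes>\<^bsub>?A\<^esub> a [^]\<^bsub>?A\<^esub> t"
        and h' = "\<lambda>_. \<one>\<^bsub>?A\<^esub>"])
    have "F (\<kappa> (a \<otimes>\<^bsub>?A\<^esub> b)) = F (\<kappa> a) \<otimes>\<^bsub>?A\<^esub> F (\<kappa> b)" if "a \<in> carrier ?A" "b \<in> carrier ?A" for a b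
      using that by (simp del: K_simps)
    then show "(\<lambda>a. F (\<kappa> a) \<otimes>\<^bsub>?A\<^esub> a [^]\<^bsub>?A\<^esub> t) \<in> hom ?A ?A"
      by (intro homI) (simp_all add: bar.A2.nat_pow_distrib bar.A2.m_ac)
    show "(\<lambda>_. \<one>\<^bsub>?A\<^esub>) \<in> hom ?A ?A" by (simp add: hom_def)
    show "\<sigma> (sec x) \<in> carrier ?A" if "x \<in> carrier I" for x using that by (simp add: sec_in)
    fix x y assume xy: "x \<in> carrier I" "y \<in> carrier I"
    have "bar.u x y [^]\<^bsub>?A\<^esub> t \<otimes>\<^bsub>?A\<^esub> \<sigma> (sec_coc x y \<otimes>\<^bsub>G\<^esub> sec (x \<otimes>\<^bsub>I\<^esub> y)) = \<sigma> (sec x) \<otimes>\<^bsub>?A\<^esub> \<sigma> (sec y)"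
      using coh[OF sec_in[OF xy(1)] sec_in[OF xy(2)]] xy by (simp add: f_def pr_sec sec_mult)
    then show "F (\<kappa> (bar.u x y)) \<otimes>\<^bsub>?A\<^esub> bar.u x y [^]\<^bsub>?A\<^esub> t \<otimes>\<^bsub>?A\<^esub> \<sigma> (sec (x \<otimes>\<^bsub>I\<^esub> y))
        = \<one>\<^bsub>?A\<^esub> \<otimes>\<^bsub>?A\<^esub> (\<sigma> (sec x) \<otimes>\<^bsub>?A\<^esub> \<sigma> (sec y))"
      using xy F_left[OF sec_coc_in[OF xy] sec_in, of "x \<otimes>\<^bsub>I\<^esub> y", symmetric] F_in[OF sec_coc_in[OF xy]]
      by (simp add: \<kappa>_u bar.u_in sec_in bar.A2.m_ac)
  qed (use a bar.comm_group_A2 in auto)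
  define c where "c = gen x0 [^]\<^bsub>G\<^esub> t"
  have c: "c \<in> carrier K" "deg c = int t"
    using x0 deg_gen deg.hom_nat_pow[of "gen x0" t] by (simp_all add: c_def gen_pow_type_in_K)
  define \<Phi> where "\<Phi> k = (deg k, F k)" for k
  have "inv_N_iso t K (integer_group \<times>\<times> bar.H2) \<Phi>"
  proof (rule inv_N_iso_criterion)
    show "comm_group K" by (rule comm_group_K)
    show "comm_group (integer_group \<times>\<times> bar.H2)"
      by (rule group.group_comm_groupI[OF DirProd_group[OF group_integer_group H.is_group]])
         (auto simp: bar.carrier_H2 bar.A2.m_comm)
    show "\<Phi> \<in> hom K (integer_group \<times>\<times> bar.H2)"
      using F_H2 hom_mult[OF deg_K] hom_mult[OF F_hom] by (intro homI) (auto simp: \<Phi>_def)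
    show "k [^]\<^bsub>K\<^esub> t = \<one>\<^bsub>K\<^esub>" if "k \<in> carrier K" "\<Phi> k = \<one>\<^bsub>integer_group \<times>\<times> bar.H2\<^esub>" for k
      using ker[of k] that by (simp add: \<Phi>_def)
    show "\<exists>k\<in>carrier K. \<Phi> k = b [^]\<^bsub>integer_group \<times>\<times> bar.H2\<^esub> (t * t)"
      if b: "b \<in> carrier (integer_group \<times>\<times> bar.H2)" for b
    proof -
      obtain n z where nz: "b = (n, z)" "z \<in> carrier bar.H2" using b by auto
      have pow: "b [^]\<^bsub>integer_group \<times>\<times> bar.H2\<^esub> m = (int m * n, z [^]\<^bsub>bar.H2\<^esub> m)" for m :: nat
        by (induction m) (auto simp: nz algebra_simps)
      interpret degK: group_hom K integer_group deg
        by (intro group_hom.intro group_hom_axioms.intro) (rule deg_K group_integer_group K.is_group)+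
      \<comment> \<open>An element of \<open>K\<close> of degree n t whose F-value is not
        controlled.\<close>
      define q where "q = c [^]\<^bsub>K\<^esub> n"
      have q: "q \<in> carrier K" "deg q = n * int t"
        using c degK.hom_int_pow[of c n] by (simp_all add: q_def del: K_simps)
      \<comment> \<open>Chosen so that F q + v = t z. Subtracting \<kappa> v from t q leaves the
        degree t^2 n unchanged, by \<open>deg_\<kappa>\<close>, and gives the F-value t F q + t v =
        t^2 z, by \<open>F_\<kappa>\<close>.\<close>
      define v where "v = z [^]\<^bsub>bar.H2\<^esub> t \<otimes>\<^bsub>bar.H2\<^esub> inv\<^bsub>bar.H2\<^esub> (F q)"
      have v: "v \<in> carrier bar.H2" using nz F_H2[OF q(1)] by (simp add: v_def del: bar.H2_simps)
      have Fq_v: "F q \<otimes>\<^bsub>bar.H2\<^esub> v = z [^]\<^bsub>bar.H2\<^esub> t"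
        using nz F_H2[OF q(1)] by (simp add: v_def H.m_comm[of "F q"] H.m_assoc del: bar.H2_simps)
      have A: "F q \<in> carrier ?A" "v \<in> carrier ?A" "z \<in> carrier ?A"
        using F_in[OF q(1)] v nz by (auto simp: bar.carrier_H2)
      define k where "k = q [^]\<^bsub>K\<^esub> t \<otimes>\<^bsub>K\<^esub> inv\<^bsub>K\<^esub> (\<kappa> v)"
      have \<kappa>v: "\<kappa> v \<in> carrier K" using A(2) by (rule \<kappa>.hom_closed)
      have "F (inv\<^bsub>K\<^esub> (\<kappa> v)) = v [^]\<^bsub>?A\<^esub> t"
        using F_\<kappa>[OF v] A \<kappa>v bar.A2.inv_equality[of "v [^]\<^bsub>?A\<^esub> t" "F (\<kappa> v)"] F_in
        by (simp add: F.hom_inv bar.A2.m_comm del: K_simps)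
      then have "F k = (F q \<otimes>\<^bsub>?A\<^esub> v) [^]\<^bsub>?A\<^esub> t"
        using q(1) \<kappa>v A by (simp add: k_def F.hom_nat_pow bar.A2.nat_pow_distrib del: K_simps)
      also have "\<dots> = z [^]\<^bsub>?A\<^esub> (t * t)"
        using Fq_v A by (simp add: bar.A2.nat_pow_pow)
      finally have "F k = z [^]\<^bsub>?A\<^esub> (t * t)" .
      moreover have "deg k = int (t * t) * n"
        using q \<kappa>v deg_\<kappa>[OF v] by (simp add: k_def degK.hom_nat_pow algebra_simps del: K_simps)
      moreover have "k \<in> carrier K" using q(1) \<kappa>v by (simp add: k_def del: K_simps)
      ultimately show ?thesis by (intro bexI[of _ k]) (simp_all add: \<Phi>_def pow)
    qed
  qed
  then show ?thesis
    unfolding bar.group_homology_2 inv_N_isomorphic_def by blast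
qed

end

theorem theorem2p1:
  fixes Q :: "'a set" and qop :: "'a \<Rightarrow> 'a \<Rightarrow> 'a"
  assumes "quandle Q qop"
    and "Q \<noteq> {}"
    and "connected_quandle Q qop"
    and "has_finite_type Q qop"
  shows "(\<forall>z\<in>carrier (group_homology (As Q qop) 2).
            z [^]\<^bsub>group_homology (As Q qop) 2\<^esub> quandle_type Q qop
              = \<one>\<^bsub>group_homology (As Q qop) 2\<^esub>)
         \<and> inv_N_isomorphic (quandle_type Q qop) (Ker_psi Q qop)
             (integer_group \<times>\<times> group_homology (Inn Q qop) 2)"
proof -
  interpret connected_quandle_on Q qop
    using assms by unfold_locales
  show ?thesis
    using H2_As_annihilated Ker_psi_inv_iso by blast
qed

end
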